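(* Fix a player $j$, the actions $a_{-j}=(a_{k})_{k\neq j}$ of the other players, the measure $m$ and $\rho>0$. Suppose that $(a_j,\lambda^*(a),\mu^*(a))$, with $a=(a_j,a_{-j})$, is a solution of the finite-dimensional problem $$(P_j^* )\qquad \inf_{a_j\in\mathcal{A}_j,\ \lambda\geq 0,\ \mu\in\mathbb{R}}\ l_j^*(a,\lambda,\mu,m),\qquad l_j^*(a,\lambda,\mu,m)=\lambda(\rho+f(1))+\mu+\int_\Omega \lambda f^*\!\left(\frac{l_j(a,\omega)-\mu}{\lambda}\right)dm(\omega).$$ Write $\lambda^*=\lambda^*(a)$ and $\mu^*=\mu^*(a)$. Then the optimal likelihood $L^*$, i.e. the function $L$ attaining the supremum over $L$ of $\int_\Omega\{L(\omega)[l_j(a,\omega)-\mu^*]-\lambda^* f(L(\omega))\}\,dm(\omega)$, satisfies $$\int_{\Omega} L^*\,dm=1,\qquad f'(L^*(\omega))=\frac{l_j(a,\omega)-\mu^*}{\lambda^*},$$ and $a_j$ together with the measure $\tilde m^*$ given by $d\tilde m^*=L^*\,dm$ provides a solution of the original problem $$(P_j)\qquad \inf_{a_j\in\mathcal{A}_j}\ \sup_{\tilde m\in B_\rho(m)}\ \mathbb{E}_{\tilde m}\, l_j(a,\omega).$$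
   Context: $(\Omega,\mathcal{F},m)$ is a probability space. There are $n\ge 2$ players; player $j$ chooses $a_j$ in $\mathcal{A}_j$, a subset of a finite-dimensional vector space, and has loss function $l_j(a,\omega)$, $a=(a_1,\dots,a_n)$. The function $f$ is convex and proper, $f'$ denotes its derivative, and $f^*(\xi)=\sup_x[\langle x,\xi\rangle-f(x)]$ is its Legendre-Fenchel transform. The $f$-divergence from $m$ to $\tilde m$ is $$D_f(\tilde m\,\|\,m)=\int_{\Omega} f\!\left(\frac{d\tilde m}{dm}\right)dm-f(1),$$ and the uncertainty set is $$B_\rho(m)=\{\tilde m \text{ probability measure on }(\Omega,\mathcal{F}),\ \tilde m\ll m \ :\ D_f(\tilde m\,\|\,m)\le\rho\}.$$ Standing assumptions: the measures $\tilde m$ are absolutely continuous with respect to $m$; the function $l_j(\cdot,\omega)$ is proper and upper semi-continuous for $m$-almost all $\omega\in\Omega$; either $\mathcal{A}_j$ is a non-empty compact set or $\mathbb{E}_{\tilde m}l_j(a,\omega)$ is coercive. The likelihood is $L(\omega)=\frac{d\tilde m}{dm}(\omega)$. "Solution of $(P_j)$" means that $a_j$ attains the infimum and $\tilde m^*$ attains the inner supremum at $a=(a_j,a_{-j})$.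
   Formalization: Added, as the claim fails or is undefined without them: λ*>0; l_j* finite for (λ,μ) near (λ*,μ* ) at the given a; L* the a.e.-unique maximiser among L≥0, with values a.e. in the interior of dom f, where f is differentiable; f=+∞ on negatives. The f' equation holds m-a.e. *)

theory Defs
  imports "HOL-Probability.Probability"
begin

section \<open>Extended-real-valued functions\<close>

definition eff_dom :: "(real \<Rightarrow> ereal) \<Rightarrow> real set" where
  "eff_dom f = {x. f x < \<infinity>}"

definition proper_on :: "'x set \<Rightarrow> ('x \<Rightarrow> ereal) \<Rightarrow> bool" where
  "proper_on S g \<longleftrightarrow> (\<forall>x\<in>S. g x \<noteq> -\<infinity>) \<and> (\<exists>x\<in>S. g x \<noteq> \<infinity>)"

text \<open>The library's \<^const>\<open>epigraph\<close> and \<^const>\<open>convex_on\<close> are for real-valued functions only;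
  an extended-real-valued function is convex iff its epigraph, a subset of the real plane, is.\<close>

definition convex_ereal :: "(real \<Rightarrow> ereal) \<Rightarrow> bool" where
  "convex_ereal f \<longleftrightarrow> convex {(x, r :: real). f x \<le> ereal r}"

definition usc_on :: "'x::topological_space set \<Rightarrow> ('x \<Rightarrow> ereal) \<Rightarrow> bool" where
  "usc_on S g \<longleftrightarrow> (\<forall>x\<in>S. \<forall>c. g x < c \<longrightarrow> (\<forall>\<^sub>F y in at x within S. g y < c))"

definition coercive_on :: "'x::real_normed_vector set \<Rightarrow> ('x \<Rightarrow> ereal) \<Rightarrow> bool" where
  "coercive_on S g \<longleftrightarrow> (g \<longlongrightarrow> \<infinity>) (inf at_infinity (principal S))"

text \<open>The argument is an \<^typ>\<open>ereal\<close> because losses may take the value \<open>\<infinity>\<close>.\<close>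

definition legendre_fenchel :: "(real \<Rightarrow> ereal) \<Rightarrow> ereal \<Rightarrow> ereal" where
  "legendre_fenchel f \<xi> = (SUP x. ereal x * \<xi> - f x)"

text \<open>The term \<open>lam f\<^sup>*(z / lam)\<close> for \<open>lam \<ge> 0\<close>. At \<open>lam = 0\<close> it is given its usual meaning, the recession
  function of \<open>f\<^sup>*\<close>, which is the support function of the domain of \<open>f\<close>; evaluating the
  formula with \<open>z / 0\<close> as totalised in HOL would give a meaningless value.\<close>

definition conj_perspective :: "(real \<Rightarrow> ereal) \<Rightarrow> real \<Rightarrow> ereal \<Rightarrow> ereal" where
  "conj_perspective f lam z =
     (if lam = 0 then (SUP x\<in>eff_dom f. ereal x * z)
      else ereal lam * legendre_fenchel f (z / ereal lam))"

section \<open>Integrals, divergence and the uncertainty set\<close>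

text \<open>Integral with values in the extended reals. If the positive and the negative part both have
  infinite integral the value is \<open>\<infinity>\<close>, because \<open>\<infinity> - \<infinity> = \<infinity>\<close> in \<^typ>\<open>ereal\<close>. The Bochner integral
  is not suitable here: it is \<open>0\<close> for non-integrable functions.\<close>

definition ext_integral :: "'w measure \<Rightarrow> ('w \<Rightarrow> ereal) \<Rightarrow> ereal" where
  "ext_integral M g =
     enn2ereal (\<integral>\<^sup>+ \<omega>. e2ennreal (g \<omega>) \<partial>M) - enn2ereal (\<integral>\<^sup>+ \<omega>. e2ennreal (- g \<omega>) \<partial>M)"

definition f_divergence :: "(real \<Rightarrow> ereal) \<Rightarrow> 'w measure \<Rightarrow> 'w measure \<Rightarrow> ereal" where
  "f_divergence f M N = ext_integral M (\<lambda>\<omega>. f (enn2real (RN_deriv M N \<omega>))) - f 1"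

definition uncertainty_set :: "(real \<Rightarrow> ereal) \<Rightarrow> real \<Rightarrow> 'w measure \<Rightarrow> 'w measure set" where
  "uncertainty_set f \<rho> M =
     {N. prob_space N \<and> sets N = sets M \<and> absolutely_continuous M N
         \<and> f_divergence f M N \<le> ereal \<rho>}"

section \<open>The robust problem of one player and its finite-dimensional form\<close>

definition worst_case :: "(real \<Rightarrow> ereal) \<Rightarrow> real \<Rightarrow> 'w measure \<Rightarrow> ('w \<Rightarrow> ereal) \<Rightarrow> ereal" where
  "worst_case f \<rho> M X = (SUP N\<in>uncertainty_set f \<rho> M. ext_integral N X)"

definition dual_loss ::
  "(real \<Rightarrow> ereal) \<Rightarrow> real \<Rightarrow> 'w measure \<Rightarrow> ('w \<Rightarrow> ereal) \<Rightarrow> real \<Rightarrow> real \<Rightarrow> ereal" where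
  "dual_loss f \<rho> M X lam \<mu> =
     ereal lam * (ereal \<rho> + f 1) + ereal \<mu>
       + ext_integral M (\<lambda>\<omega>. conj_perspective f lam (X \<omega> - ereal \<mu>))"

text \<open>Below, \<open>A k\<close> is the action set of player \<open>k\<close>, \<open>X\<close> is the loss of the player \<open>j\<close> under
  consideration, and \<open>a\<close> is a full action profile, so that \<open>a(j := x)\<close> is \<open>(x, a\<^sub>-\<^sub>j)\<close>.\<close>

definition solves_primal where
  "solves_primal f \<rho> M (A :: 'p \<Rightarrow> 'v set) (X :: ('p \<Rightarrow> 'v) \<Rightarrow> 'w \<Rightarrow> ereal) j a N \<longleftrightarrow>
     a j \<in> A j
     \<and> worst_case f \<rho> M (X a) = (INF x\<in>A j. worst_case f \<rho> M (X (a(j := x))))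
     \<and> N \<in> uncertainty_set f \<rho> M
     \<and> ext_integral N (X a) = worst_case f \<rho> M (X a)"

definition solves_dual where
  "solves_dual f \<rho> M (A :: 'p \<Rightarrow> 'v set) (X :: ('p \<Rightarrow> 'v) \<Rightarrow> 'w \<Rightarrow> ereal) j a lam \<mu> \<longleftrightarrow>
     a j \<in> A j \<and> 0 \<le> lam
     \<and> dual_loss f \<rho> M (X a) lam \<mu>
       = (INF (x, lam', \<mu>')\<in>A j \<times> {0..} \<times> UNIV. dual_loss f \<rho> M (X (a(j := x))) lam' \<mu>')"

definition likelihoods :: "'w measure \<Rightarrow> ('w \<Rightarrow> real) set" where
  "likelihoods M = {L \<in> borel_measurable M. \<forall>\<omega>\<in>space M. 0 \<le> L \<omega>}"

definition likelihood_objective ::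
  "(real \<Rightarrow> ereal) \<Rightarrow> 'w measure \<Rightarrow> ('w \<Rightarrow> ereal) \<Rightarrow> real \<Rightarrow> real \<Rightarrow> ('w \<Rightarrow> real) \<Rightarrow> ereal" where
  "likelihood_objective f M X lam \<mu> L =
     ext_integral M (\<lambda>\<omega>. ereal (L \<omega>) * (X \<omega> - ereal \<mu>) - ereal lam * f (L \<omega>))"

text \<open>\<open>L\<close> is \<^emph>\<open>the\<close> maximiser: it attains the supremum and every maximiser agrees with it almost
  everywhere. The constraint \<open>\<integral> L dM = 1\<close> is not imposed; \<open>\<mu>\<close> is its multiplier.\<close>

definition optimal_likelihood ::
  "(real \<Rightarrow> ereal) \<Rightarrow> 'w measure \<Rightarrow> ('w \<Rightarrow> ereal) \<Rightarrow> real \<Rightarrow> real \<Rightarrow> ('w \<Rightarrow> real) \<Rightarrow> bool" where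
  "optimal_likelihood f M X lam \<mu> L \<longleftrightarrow>
     L \<in> likelihoods M
     \<and> likelihood_objective f M X lam \<mu> L
         = (SUP L'\<in>likelihoods M. likelihood_objective f M X lam \<mu> L')
     \<and> (\<forall>L'\<in>likelihoods M.
           likelihood_objective f M X lam \<mu> L' = likelihood_objective f M X lam \<mu> L
           \<longrightarrow> (AE \<omega> in M. L' \<omega> = L \<omega>))"

end

theory Submission
  imports Defs
begin

text \<open>
  The proof is Lagrangian duality for the inner supremum. The loss enters the dual problem through the
  pointwise maximal payoff \<open>sup\<^sub>y [y (x - \<mu>) - lam f(y)]\<close>, which for \<open>lam \<ge> 0\<close> is the perspective of the
  conjugate of \<open>f\<close>.

  \<^bold>\<open>First-order conditions.\<close> A likelihood maximising the integrated Lagrangian maximises it pointwise, and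
  because it is the only maximiser almost everywhere, so is the pointwise maximiser
  (\<open>optimal_likelihood_pointwise\<close>). An interior maximiser is a critical point, which is the formula for
  \<open>f'(L)\<close>. Uniqueness moreover makes the maximal payoff differentiable in both multipliers, with
  derivatives \<open>- L\<close> in \<open>\<mu>\<close> and \<open>- f(L)\<close> in \<open>lam\<close> (\<open>maximal_payoff_line_derivative\<close>). The dual loss is finite
  near its minimum and its integrand is convex, so one may differentiate under the integral sign;
  stationarity in \<open>\<mu>\<close> and \<open>lam\<close> reads \<open>\<integral> L = 1\<close> and \<open>\<integral> f(L) = \<rho> + f(1)\<close>. Hence \<open>L dm\<close> lies in
  the uncertainty set, and its expected loss equals the dual optimum. By weak duality no measure of the
  uncertainty set does better at the same action (\<open>dual_optimum\<close>).

  \<^bold>\<open>Comparison with other actions.\<close> The dual optimum \<open>d\<close> is at most the dual loss of every other action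
  at all multipliers. For it to be at most the worst case of that action, strong duality is required
  there, although nothing is known about the integrability of that action's loss. If some likelihood has
  finite mass, divergence and expected loss, then a separating hyperplane in \<open>\<real>\<^sup>3\<close> provides multipliers
  (\<open>lagrange_multipliers\<close>); Slater's condition holds as \<open>1\<close> is interior to the domain of \<open>f\<close> and
  \<open>\<rho> > 0\<close>. Such a likelihood exists as soon as the dual loss is finite somewhere
  (\<open>admissible_nonempty\<close>), since it is bounded below by \<open>d\<close>. If the dual loss is \<open>\<infinity>\<close> everywhere, either
  the positive part of the loss has infinite expectation under \<open>m\<close> itself, or the same argument applied to
  it shows that its expectations over the uncertainty set are unbounded, and a countable mixture of measures
  then has infinite expected loss (\<open>infinite_expectation_mixture\<close>).
\<close>

section \<open>The extended integral\<close>

lemma ext_integral_cong_AE: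
  assumes "AE \<omega> in M. g \<omega> = h \<omega>"
  shows "ext_integral M g = ext_integral M h"
proof -
  have "(\<integral>\<^sup>+ \<omega>. e2ennreal (g \<omega>) \<partial>M) = (\<integral>\<^sup>+ \<omega>. e2ennreal (h \<omega>) \<partial>M)"
    "(\<integral>\<^sup>+ \<omega>. e2ennreal (- g \<omega>) \<partial>M) = (\<integral>\<^sup>+ \<omega>. e2ennreal (- h \<omega>) \<partial>M)"
    using assms by (auto intro!: nn_integral_cong_AE)
  then show ?thesis by (simp add: ext_integral_def)
qed

lemma ext_integral_mono_AE:
  assumes "AE \<omega> in M. g \<omega> \<le> h \<omega>"
  shows "ext_integral M g \<le> ext_integral M h"
  unfolding ext_integral_def
proof (rule ereal_minus_mono)
  show "enn2ereal (\<integral>\<^sup>+ \<omega>. e2ennreal (g \<omega>) \<partial>M) \<le> enn2ereal (\<integral>\<^sup>+ \<omega>. e2ennreal (h \<omega>) \<partial>M)"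
    using assms unfolding less_eq_ennreal.rep_eq[symmetric]
    by (intro nn_integral_mono_AE) (auto intro: e2ennreal_mono)
  show "enn2ereal (\<integral>\<^sup>+ \<omega>. e2ennreal (- h \<omega>) \<partial>M) \<le> enn2ereal (\<integral>\<^sup>+ \<omega>. e2ennreal (- g \<omega>) \<partial>M)"
    using assms unfolding less_eq_ennreal.rep_eq[symmetric]
    by (intro nn_integral_mono_AE) (auto intro!: e2ennreal_mono)
qed

lemma ext_integral_real:
  assumes "integrable M h"
  shows "ext_integral M (\<lambda>\<omega>. ereal (h \<omega>)) = ereal (integral\<^sup>L M h)"
proof -
  from assms obtain r q where "0 \<le> r" "0 \<le> q"
    "(\<integral>\<^sup>+x. ennreal (h x)\<partial>M) = ennreal r"
    "(\<integral>\<^sup>+x. ennreal (- h x)\<partial>M) = ennreal q" "integral\<^sup>L M h = r - q"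
    by (rule integrableE)
  then show ?thesis by (simp add: ext_integral_def)
qed

lemma ext_integral_eq_infinity:
  assumes "(\<integral>\<^sup>+ \<omega>. e2ennreal (g \<omega>) \<partial>M) = \<infinity>"
  shows "ext_integral M g = \<infinity>"
  using assms by (simp add: ext_integral_def)

lemma ext_integral_finite_iff_parts:
  "\<bar>ext_integral M g\<bar> \<noteq> \<infinity> \<longleftrightarrow>
     (\<integral>\<^sup>+ \<omega>. e2ennreal (g \<omega>) \<partial>M) \<noteq> \<infinity> \<and> (\<integral>\<^sup>+ \<omega>. e2ennreal (- g \<omega>) \<partial>M) \<noteq> \<infinity>"
  unfolding ext_integral_def
  by (cases "\<integral>\<^sup>+ \<omega>. e2ennreal (g \<omega>) \<partial>M"; cases "\<integral>\<^sup>+ \<omega>. e2ennreal (- g \<omega>) \<partial>M") auto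

text \<open>A finite value of the extended integral brings us back to the Bochner integral of a real
  function; every limit argument below happens there.\<close>

lemma ext_integral_finite:
  assumes g[measurable]: "g \<in> borel_measurable M" and fin: "\<bar>ext_integral M g\<bar> \<noteq> \<infinity>"
  shows "AE \<omega> in M. \<bar>g \<omega>\<bar> \<noteq> \<infinity>"
    and "integrable M (\<lambda>\<omega>. real_of_ereal (g \<omega>))"
    and "ext_integral M g = ereal (\<integral>\<omega>. real_of_ereal (g \<omega>) \<partial>M)"
proof -
  from fin have parts: "(\<integral>\<^sup>+ \<omega>. e2ennreal (g \<omega>) \<partial>M) \<noteq> \<infinity>"
      "(\<integral>\<^sup>+ \<omega>. e2ennreal (- g \<omega>) \<partial>M) \<noteq> \<infinity>"
    by (simp_all add: ext_integral_finite_iff_parts)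
  have "AE \<omega> in M. e2ennreal (g \<omega>) \<noteq> \<infinity>" "AE \<omega> in M. e2ennreal (- g \<omega>) \<noteq> \<infinity>"
    by (rule nn_integral_PInf_AE; use parts in simp)+
  then show *: "AE \<omega> in M. \<bar>g \<omega>\<bar> \<noteq> \<infinity>"
    by eventually_elim auto
  then have eqs: "AE \<omega> in M. ennreal (real_of_ereal (g \<omega>)) = e2ennreal (g \<omega>)"
      "AE \<omega> in M. ennreal (- real_of_ereal (g \<omega>)) = e2ennreal (- g \<omega>)"
      "AE \<omega> in M. g \<omega> = ereal (real_of_ereal (g \<omega>))"
    by (eventually_elim, metis e2ennreal_ereal ereal_real uminus_ereal.simps(1))+
  from eqs(1,2)[THEN nn_integral_cong_AE] parts
  show int: "integrable M (\<lambda>\<omega>. real_of_ereal (g \<omega>))"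
    by (simp add: real_integrable_def)
  show "ext_integral M g = ereal (\<integral>\<omega>. real_of_ereal (g \<omega>) \<partial>M)"
    using ext_integral_cong_AE[OF eqs(3)] ext_integral_real[OF int] by simp
qed

lemma ext_integral_density:
  assumes L[measurable]: "L \<in> borel_measurable M" and X[measurable]: "X \<in> borel_measurable M"
    and nonneg: "\<And>\<omega>. \<omega> \<in> space M \<Longrightarrow> 0 \<le> L \<omega>"
  shows "ext_integral (density M (\<lambda>\<omega>. ennreal (L \<omega>))) X = ext_integral M (\<lambda>\<omega>. ereal (L \<omega>) * X \<omega>)"
proof -
  have pos: "e2ennreal (ereal c * x) = ennreal c * e2ennreal x" if "0 \<le> c" for c and x :: ereal
  proof (cases x)
    case (real r) then show ?thesis using that by (simp add: ennreal_mult' )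
  next
    case PInf then show ?thesis using that
      by (cases "c = 0") (auto simp: ennreal_mult_top)
  next
    case MInf then show ?thesis using that
      by (cases "c = 0") (auto simp: e2ennreal_neg)
  qed
  have neg: "e2ennreal (- (ereal c * x)) = ennreal c * e2ennreal (- x)" if "0 \<le> c" for c and x :: ereal
    using pos[OF that, of "- x"] by simp
  show ?thesis
    unfolding ext_integral_def
    by (simp add: nn_integral_density pos neg nonneg cong: nn_integral_cong)
qed

section \<open>Convex generators of divergences\<close>

locale divergence_generator =
  fixes f :: "real \<Rightarrow> ereal"
  assumes f_convex: "convex_ereal f"
    and f_proper: "proper_on UNIV f"
    and f_dom: "\<And>x. x < 0 \<Longrightarrow> f x = \<infinity>"
begin

abbreviation F :: "real \<Rightarrow> real" where "F y \<equiv> real_of_ereal (f y)"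
abbreviation I :: "real set" where "I \<equiv> eff_dom f"

lemma f_eq_F: "y \<in> I \<Longrightarrow> f y = ereal (F y)"
  using f_proper by (cases "f y") (auto simp: eff_dom_def proper_on_def)

lemma f_finite: "y \<in> I \<Longrightarrow> \<exists>r. f y = ereal r"
  using f_eq_F by blast

lemma f_le_iff: "y \<in> I \<Longrightarrow> f y \<le> ereal r \<longleftrightarrow> F y \<le> r"
  using f_finite[of y] by auto

lemma f_outside: "y \<notin> I \<Longrightarrow> f y = \<infinity>"
  by (simp add: eff_dom_def)

lemma I_nonneg: "y \<in> I \<Longrightarrow> 0 \<le> y"
  using f_dom[of y] by (cases "y < 0") (auto simp: eff_dom_def)

lemma I_nonempty: "I \<noteq> {}"
  using f_proper by (auto simp: eff_dom_def proper_on_def)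

lemma F_convex: "convex_on I F" and I_convex: "convex I"
proof -
  have *: "u * x + v * y \<in> I \<and> F (u * x + v * y) \<le> u * F x + v * F y"
    if "x \<in> I" "y \<in> I" "0 \<le> u" "0 \<le> v" "u + v = 1" for x y u v
  proof -
    have "(x, F x) \<in> {(x, r). f x \<le> ereal r}" "(y, F y) \<in> {(x, r). f x \<le> ereal r}"
      using that by (auto simp: f_le_iff)
    from convexD[OF f_convex[unfolded convex_ereal_def] this that(3-5)]
    have "u *\<^sub>R (x, F x) + v *\<^sub>R (y, F y) \<in> {(x, r). f x \<le> ereal r}" .
    then have le: "f (u * x + v * y) \<le> ereal (u * F x + v * F y)" by simp
    then have "u * x + v * y \<in> I"
      unfolding eff_dom_def by (auto intro: le_less_trans)
    with le show ?thesis by (simp add: f_le_iff)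
  qed
  show c: "convex I"
    unfolding convex_def using * by auto
  show "convex_on I F"
    unfolding convex_on_def using c * by auto
qed

lemma f_measurable [measurable]: "f \<in> borel_measurable borel"
proof (rule borel_measurableI_le)
  fix c :: ereal
  have "convex {x. f x \<le> c}"
  proof (cases c)
    case (real r)
    show ?thesis
    proof (rule convexI)
      fix x y u v :: real
      assume *: "x \<in> {x. f x \<le> c}" "y \<in> {x. f x \<le> c}" "0 \<le> u" "0 \<le> v" "u + v = 1"
      then have "x \<in> I" "y \<in> I"
        using real by (auto simp: eff_dom_def intro: le_less_trans)
      moreover from this * real have "F x \<le> r" "F y \<le> r"
        by (auto simp: f_le_iff)
      ultimately have "u * F x + v * F y \<le> r" "u * x + v * y \<in> I"
          "F (u * x + v * y) \<le> u * F x + v * F y"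
        using * F_convex I_convex convex_bound_le[of "F x" r "F y" u v]
        by (auto simp: convex_on_def convex_def)
      then have "F (u * x + v * y) \<le> r" "u * x + v * y \<in> I" by auto
      then show "u *\<^sub>R x + v *\<^sub>R y \<in> {x. f x \<le> c}"
        using real by (simp add: f_le_iff)
    qed
  next
    case MInf
    then have "{x. f x \<le> c} = {}" using f_proper by (auto simp: proper_on_def)
    then show ?thesis by simp
  qed simp
  then show "{x \<in> space borel. f x \<le> c} \<in> sets borel"
    using real_interval_borel_measurable by (simp add: is_interval_convex_1)
qed

lemma I_borel [measurable]: "I \<in> sets borel"
  using I_convex real_interval_borel_measurable by (simp add: is_interval_convex_1)

text \<open>With \<open>z\<close> the centred loss \<open>x - \<mu>\<close> this is the integrand of the dual loss, written as a supremum of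
  functions linear in \<open>(lam, z)\<close>, from which its convexity and monotonicity can be read off.\<close>

definition maximal_payoff :: "real \<Rightarrow> real \<Rightarrow> ereal" where
  "maximal_payoff lam z = (SUP y\<in>I. ereal (y * z - lam * F y))"

lemma maximal_payoff_upper: "y \<in> I \<Longrightarrow> ereal (y * z - lam * F y) \<le> maximal_payoff lam z"
  unfolding maximal_payoff_def by (rule SUP_upper)

lemma maximal_payoff_least:
  "(\<And>y. y \<in> I \<Longrightarrow> ereal (y * z - lam * F y) \<le> b) \<Longrightarrow> maximal_payoff lam z \<le> b"
  unfolding maximal_payoff_def by (rule SUP_least)

lemma maximal_payoff_not_MInf: "maximal_payoff lam z \<noteq> -\<infinity>"
  using I_nonempty maximal_payoff_upper[of _ z lam] by fastforce

lemma maximal_payoff_mono: "x \<le> z \<Longrightarrow> maximal_payoff lam x \<le> maximal_payoff lam z"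
  by (rule maximal_payoff_least, rule order_trans[OF _ maximal_payoff_upper])
     (auto intro: mult_left_mono I_nonneg)

text \<open>At \<open>lam = 0\<close> the payoff ignores \<open>f\<close> except for its domain, in agreement with the recession function
  in the definition of the perspective.\<close>

lemma conj_perspective_real:
  assumes "0 \<le> lam"
  shows "conj_perspective f lam (ereal z) = maximal_payoff lam z"
proof (cases "lam = 0")
  case True
  then show ?thesis by (simp add: conj_perspective_def maximal_payoff_def)
next
  case False
  with assms have lam: "0 < lam" by simp
  have "ereal lam * legendre_fenchel f (ereal z / ereal lam)
      = (SUP y. ereal lam * (ereal y * (ereal z / ereal lam) - f y))"
    unfolding legendre_fenchel_def using lam by (subst Sup_ereal_mult_left') auto
  also have "\<dots> = maximal_payoff lam z"
  proof (rule antisym)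
    show "(SUP y. ereal lam * (ereal y * (ereal z / ereal lam) - f y)) \<le> maximal_payoff lam z"
    proof (rule SUP_least)
      fix y
      show "ereal lam * (ereal y * (ereal z / ereal lam) - f y) \<le> maximal_payoff lam z"
      proof (cases "y \<in> I")
        case True
        with f_finite obtain r where "f y = ereal r" by blast
        then have "ereal lam * (ereal y * (ereal z / ereal lam) - f y) = ereal (y * z - lam * F y)"
          using lam by (simp add: field_simps)
        with maximal_payoff_upper[OF True] show ?thesis by simp
      next
        case False
        with lam f_outside show ?thesis by (auto simp: ereal_mult_eq_MInfty)
      qed
    qed
    show "maximal_payoff lam z \<le> (SUP y. ereal lam * (ereal y * (ereal z / ereal lam) - f y))"
    proof (rule maximal_payoff_least)
      fix y assume "y \<in> I"
      with f_finite obtain r where "f y = ereal r" by blast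
      then have *: "ereal (y * z - lam * F y) = ereal lam * (ereal y * (ereal z / ereal lam) - f y)"
        using lam by (simp add: field_simps)
      show "ereal (y * z - lam * F y) \<le> (SUP y. ereal lam * (ereal y * (ereal z / ereal lam) - f y))"
        unfolding * by (rule SUP_upper) simp
    qed
  qed
  finally show ?thesis using False by (simp add: conj_perspective_def)
qed

lemma conj_perspective_infinity:
  assumes "0 < lam"
  shows "conj_perspective f lam \<infinity> = \<infinity>"
proof -
  have "\<infinity> = ereal 1 * (\<infinity> / ereal lam) - f 1"
    using assms by (cases "f 1") (auto simp: divide_ereal_def)
  also have "\<dots> \<le> legendre_fenchel f (\<infinity> / ereal lam)"
    unfolding legendre_fenchel_def by (rule SUP_upper) simp
  finally show ?thesis using assms by (simp add: conj_perspective_def)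
qed

text \<open>Countably many \<open>y\<close> suffice, uniformly in \<open>lam\<close> and \<open>z\<close>. They are taken dense in the graph of \<open>f\<close>
  and not just in its domain, because \<open>f\<close> may jump at the ends of its domain.\<close>

lemma countable_determining_set:
  obtains e :: "nat \<Rightarrow> real" where "range e \<subseteq> I"
    and "\<And>lam z b y. \<forall>k. e k * z - lam * F (e k) \<le> b \<Longrightarrow> y \<in> I \<Longrightarrow> y * z - lam * F y \<le> b"
proof -
  let ?S = "(\<lambda>y. (y, F y)) ` I"
  obtain T where T: "countable T" "T \<subseteq> ?S" "?S \<subseteq> closure T"
    using separable[of ?S] by blast
  then have "T \<noteq> {}" using I_nonempty by auto
  define e where "e k = fst (from_nat_into T k)" for k
  have e: "from_nat_into T k = (e k, F (e k))" "e k \<in> I" for k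
    using from_nat_into[OF \<open>T \<noteq> {}\<close>, of k] T(2) unfolding e_def by auto
  show thesis
  proof (rule that[of e])
    show "range e \<subseteq> I" using e by auto
    fix lam z b y
    assume le: "\<forall>k. e k * z - lam * F (e k) \<le> b" and y: "y \<in> I"
    let ?H = "{p :: real \<times> real. fst p * z - lam * snd p \<le> b}"
    have "closed ?H"
      by (intro closed_Collect_le continuous_intros)
    moreover have "T \<subseteq> ?H"
    proof
      fix p assume "p \<in> T"
      then obtain k where "p = from_nat_into T k"
        using T(1) by (metis from_nat_into_surj)
      with e le show "p \<in> ?H" by simp
    qed
    ultimately have "?S \<subseteq> ?H" using T(3) closure_minimal by blast
    with y show "y * z - lam * F y \<le> b" by auto
  qed
qed

lemma maximal_payoff_countable:
  obtains e :: "nat \<Rightarrow> real" where "range e \<subseteq> I"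
    and "maximal_payoff = (\<lambda>lam z. SUP k. ereal (e k * z - lam * F (e k)))"
proof -
  obtain e :: "nat \<Rightarrow> real" where e: "range e \<subseteq> I"
    and dense: "\<And>lam z b y. \<forall>k. e k * z - lam * F (e k) \<le> b \<Longrightarrow> y \<in> I \<Longrightarrow> y * z - lam * F y \<le> b"
    using countable_determining_set by blast
  have "maximal_payoff lam z = (SUP k. ereal (e k * z - lam * F (e k)))" for lam z
  proof (rule antisym)
    show "(SUP k. ereal (e k * z - lam * F (e k))) \<le> maximal_payoff lam z"
      using e by (auto intro!: SUP_least maximal_payoff_upper)
    show "maximal_payoff lam z \<le> (SUP k. ereal (e k * z - lam * F (e k)))" (is "_ \<le> ?s")
    proof (cases ?s)
      case (real b)
      have "e k * z - lam * F (e k) \<le> b" for k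
        using SUP_upper[of k UNIV "\<lambda>k. ereal (e k * z - lam * F (e k))"] real by simp
      then show ?thesis
        unfolding real by (intro maximal_payoff_least) (use dense in auto)
    next
      case MInf
      then show ?thesis
        using SUP_upper[of 0 UNIV "\<lambda>k. ereal (e k * z - lam * F (e k))"] by simp
    qed simp
  qed
  then show thesis by (intro that[OF e] ext)
qed

lemma maximal_payoff_measurable [measurable]: "maximal_payoff lam \<in> borel_measurable borel"
proof -
  obtain e :: "nat \<Rightarrow> real" where "range e \<subseteq> I"
    and "maximal_payoff = (\<lambda>lam z. SUP k. ereal (e k * z - lam * F (e k)))"
    by (rule maximal_payoff_countable)
  then show ?thesis by simp
qed

lemma dual_loss_real:
  assumes "0 \<le> lam" "1 \<in> I"
  shows "dual_loss f \<rho> M (\<lambda>\<omega>. ereal (X \<omega>)) lam \<mu>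
    = ereal (lam * (\<rho> + F 1) + \<mu>) + ext_integral M (\<lambda>\<omega>. maximal_payoff lam (X \<omega> - \<mu>))"
proof -
  have "ereal lam * (ereal \<rho> + f 1) + ereal \<mu> = ereal (lam * (\<rho> + F 1) + \<mu>)"
    using f_finite[OF assms(2)] by auto
  then show ?thesis
    using assms(1) by (simp add: dual_loss_def conj_perspective_real)
qed

lemma dual_loss_cong_AE:
  assumes "AE \<omega> in M. X \<omega> = Y \<omega>"
  shows "dual_loss f \<rho> M X lam \<mu> = dual_loss f \<rho> M Y lam \<mu>"
  unfolding dual_loss_def using assms
  by (auto intro!: arg_cong[where f="\<lambda>x. _ + x"] ext_integral_cong_AE)

end

section \<open>Differentiating an integral of convex functions\<close>

lemma convex_difference_quotient_bound:
  fixes h :: "real \<Rightarrow> real"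
  assumes h: "convex_on {-e..e} h" and t: "t \<noteq> 0" "\<bar>t\<bar> \<le> e"
  shows "\<bar>(h t - h 0) / t\<bar> \<le> \<bar>(h e - h 0) / e\<bar> + \<bar>(h 0 - h (- e)) / e\<bar>"
proof -
  have e: "0 < e" using t by auto
  have right: "h s - h 0 \<le> s * ((h e - h 0) / e)" if "0 \<le> s" "s \<le> e" for s
    using convex_onD[OF h, of "s / e" 0 e] e that by (simp add: field_simps)
  have left: "h (- s) - h 0 \<le> s * ((h (- e) - h 0) / e)" if "0 \<le> s" "s \<le> e" for s
    using convex_onD[OF h, of "s / e" 0 "- e"] e that by (simp add: field_simps)
  have mid: "2 * h 0 \<le> h s + h (- s)" if "0 \<le> s" "s \<le> e" for s
    using convex_onD[OF h, of "1/2" "- s" s] e that by (simp add: field_simps)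
  define A where "A = (h e - h 0) / e"
  define B where "B = (h 0 - h (- e)) / e"
  have bounds: "s * B \<le> h s - h 0 \<and> h s - h 0 \<le> s * A \<and> s * B \<le> h 0 - h (- s) \<and> h 0 - h (- s) \<le> s * A"
    if "0 < s" "s \<le> e" for s
  proof -
    have "(h (- e) - h 0) / e = - B" by (simp add: B_def minus_divide_left)
    then show ?thesis using right[of s] left[of s] mid[of s] that by (simp add: A_def)
  qed
  have "B \<le> (h t - h 0) / t \<and> (h t - h 0) / t \<le> A"
  proof (cases "0 < t")
    case True
    with bounds[of t] t show ?thesis by (simp add: field_simps)
  next
    case False
    with bounds[of "- t"] t show ?thesis by (simp add: field_simps)
  qed
  then show ?thesis unfolding A_def[symmetric] B_def[symmetric] by linarith
qed

text \<open>If \<open>t \<mapsto> s t + \<integral> G t\<close> is minimal at \<open>0\<close>, then \<open>s + \<integral> \<kappa> = 0\<close>, where \<open>\<kappa>\<close> is the pointwise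
  derivative of \<open>G\<close>. Differentiation under the integral sign is legitimate because the difference
  quotients of a convex function are monotone: those at the ends of the interval dominate all others.\<close>

lemma integral_convex_stationary:
  fixes G :: "real \<Rightarrow> 'w \<Rightarrow> real"
  assumes e: "0 < e"
    and int: "\<And>t. \<bar>t\<bar> \<le> e \<Longrightarrow> integrable M (G t)"
    and conv: "AE \<omega> in M. convex_on {-e..e} (\<lambda>t. G t \<omega>)"
    and deriv: "AE \<omega> in M. ((\<lambda>t. G t \<omega>) has_real_derivative \<kappa> \<omega>) (at 0)"
    and meas: "\<kappa> \<in> borel_measurable M"
    and min: "\<And>t. \<bar>t\<bar> \<le> e \<Longrightarrow> (\<integral>\<omega>. G 0 \<omega> \<partial>M) \<le> s * t + (\<integral>\<omega>. G t \<omega> \<partial>M)"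
  shows "integrable M \<kappa> \<and> (\<integral>\<omega>. \<kappa> \<omega> \<partial>M) = - s"
proof -
  define q where "q t \<omega> = (G t \<omega> - G 0 \<omega>) / t" for t \<omega>
  define w where "w \<omega> = \<bar>(G e \<omega> - G 0 \<omega>) / e\<bar> + \<bar>(G 0 \<omega> - G (- e) \<omega>) / e\<bar>" for \<omega>
  have int0: "integrable M (G 0)" using int[of 0] e by simp
  have w: "integrable M w"
    unfolding w_def using e int int0 by auto
  have lim: "integrable M \<kappa> \<and> (\<lambda>n. \<integral>\<omega>. q (t n) \<omega> \<partial>M) \<longlonglongrightarrow> (\<integral>\<omega>. \<kappa> \<omega> \<partial>M)"
    if t: "\<And>n. t n \<noteq> 0" "\<And>n. \<bar>t n\<bar> \<le> e" "t \<longlonglongrightarrow> 0" for t :: "nat \<Rightarrow> real"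
  proof -
    have "AE \<omega> in M. (\<lambda>n. q (t n) \<omega>) \<longlonglongrightarrow> \<kappa> \<omega>"
      using deriv
    proof eventually_elim
      case (elim \<omega>)
      then have "(\<lambda>x. (G x \<omega> - G 0 \<omega>) / x) \<midarrow>0\<rightarrow> \<kappa> \<omega>" by (simp add: DERIV_def)
      with t show ?case
        unfolding tendsto_at_iff_sequentially comp_def q_def by auto
    qed
    moreover have "AE \<omega> in M. norm (q (t n) \<omega>) \<le> w \<omega>" for n
      using conv
    proof eventually_elim
      case (elim \<omega>)
      with convex_difference_quotient_bound[OF elim t(1,2)] show ?case
        by (simp add: q_def w_def)
    qed
    moreover have "q (t n) \<in> borel_measurable M" for n
      unfolding q_def using int[OF t(2)] int0 by auto
    ultimately show ?thesis
      using meas w integrable_dominated_convergence[of \<kappa> M "\<lambda>n. q (t n)" w]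
        integral_dominated_convergence[of \<kappa> M "\<lambda>n. q (t n)" w] by blast
  qed
  have q_int: "(\<integral>\<omega>. q t \<omega> \<partial>M) = ((\<integral>\<omega>. G t \<omega> \<partial>M) - (\<integral>\<omega>. G 0 \<omega> \<partial>M)) / t" if "\<bar>t\<bar> \<le> e" for t
    unfolding q_def using int[OF that] int0 by simp
  define t where "t n = e / real (Suc n)" for n
  have t: "0 < t n" "t n \<le> e" for n
    using e by (auto simp: t_def field_simps)
  have t0: "t \<longlonglongrightarrow> 0"
    unfolding t_def using lim_const_over_n[of e, THEN LIMSEQ_Suc] by simp
  have pos: "integrable M \<kappa> \<and> (\<lambda>n. \<integral>\<omega>. q (t n) \<omega> \<partial>M) \<longlonglongrightarrow> (\<integral>\<omega>. \<kappa> \<omega> \<partial>M)"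
    using t t0 by (intro lim) (auto simp: less_imp_neq[symmetric] less_imp_le abs_of_pos)
  have neg: "(\<lambda>n. \<integral>\<omega>. q (- t n) \<omega> \<partial>M) \<longlonglongrightarrow> (\<integral>\<omega>. \<kappa> \<omega> \<partial>M)"
    using t tendsto_minus[OF t0]
    by (intro conjunct2[OF lim]) (auto simp: less_imp_neq[symmetric] less_imp_le abs_of_pos)

  have "- s \<le> (\<integral>\<omega>. q (t n) \<omega> \<partial>M)" for n
  proof -
    have "t n * (\<integral>\<omega>. q (t n) \<omega> \<partial>M) = (\<integral>\<omega>. G (t n) \<omega> \<partial>M) - (\<integral>\<omega>. G 0 \<omega> \<partial>M)"
      using t[of n] q_int[of "t n"] by simp
    then have "0 \<le> t n * (s + (\<integral>\<omega>. q (t n) \<omega> \<partial>M))"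
      using min[of "t n"] t[of n] by (simp add: algebra_simps)
    then show ?thesis using t(1)[of n] by (simp add: zero_le_mult_iff)
  qed
  then have "- s \<le> (\<integral>\<omega>. \<kappa> \<omega> \<partial>M)"
    using LIMSEQ_le_const[OF conjunct2[OF pos]] by blast
  moreover have "(\<integral>\<omega>. q (- t n) \<omega> \<partial>M) \<le> - s" for n
  proof -
    have "- t n * (\<integral>\<omega>. q (- t n) \<omega> \<partial>M) = (\<integral>\<omega>. G (- t n) \<omega> \<partial>M) - (\<integral>\<omega>. G 0 \<omega> \<partial>M)"
      using t[of n] q_int[of "- t n"] by simp
    then have "0 \<le> - t n * (s + (\<integral>\<omega>. q (- t n) \<omega> \<partial>M))"
      using min[of "- t n"] t[of n] by (simp add: algebra_simps)
    then show ?thesis using t(1)[of n] by (simp add: mult_le_0_iff)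
  qed
  then have "(\<integral>\<omega>. \<kappa> \<omega> \<partial>M) \<le> - s"
    using LIMSEQ_le_const2[OF neg] by blast
  ultimately show ?thesis using pos by simp
qed

section \<open>The maximal payoff along a line of multipliers\<close>

context divergence_generator
begin

lemma maximal_payoff_line_convex:
  fixes u v z lam e :: real
  defines "P \<equiv> \<lambda>t. maximal_payoff (lam + t * u) (z - t * v)"
  assumes "\<bar>P e\<bar> \<noteq> \<infinity>" "\<bar>P (- e)\<bar> \<noteq> \<infinity>"
  shows "convex_on {-e..e} (\<lambda>t. real_of_ereal (P t))"
proof -
  define o' where "o' t y = y * (z - t * v) - (lam + t * u) * F y" for t y
  have P: "P t = (SUP y\<in>I. ereal (o' t y))" for t
    by (simp add: P_def o'_def maximal_payoff_def)
  have up: "ereal (o' t y) \<le> P t" if "y \<in> I" for t y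
    unfolding P using that by (rule SUP_upper)
  have comb: "o' (a * t + b * s) y = a * o' t y + b * o' s y" if "a + b = 1" for a b t s y
  proof -
    have "b = 1 - a" using that by simp
    show ?thesis unfolding \<open>b = 1 - a\<close> by (simp add: o'_def algebra_simps)
  qed
  have bound: "P (a * t + b * s) \<le> ereal (a * real_of_ereal (P t) + b * real_of_ereal (P s))"
    if fin: "\<bar>P t\<bar> \<noteq> \<infinity>" "\<bar>P s\<bar> \<noteq> \<infinity>" and ab: "0 \<le> a" "0 \<le> b" "a + b = 1" for a b t s
    unfolding P[of "a * t + b * s"]
  proof (rule SUP_least)
    fix y assume y: "y \<in> I"
    have "o' t y \<le> real_of_ereal (P t)" "o' s y \<le> real_of_ereal (P s)"
      using up[OF y, of t] up[OF y, of s] fin by (cases "P t"; cases "P s"; simp)+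
    then have "a * o' t y + b * o' s y \<le> a * real_of_ereal (P t) + b * real_of_ereal (P s)"
      using ab by (intro add_mono mult_left_mono)
    then show "ereal (o' (a * t + b * s) y) \<le> ereal (a * real_of_ereal (P t) + b * real_of_ereal (P s))"
      using comb[OF ab(3)] by simp
  qed
  have fin: "\<bar>P t\<bar> \<noteq> \<infinity>" if t: "t \<in> {-e..e}" for t
  proof (cases "e = 0")
    case True with t assms show ?thesis by auto
  next
    case False
    define a where "a = (e + t) / (2 * e)"
    have e: "0 < e" using t False by auto
    have ab: "0 \<le> a" "0 \<le> 1 - a" "a * e + (1 - a) * (- e) = t"
      using t e by (auto simp: a_def field_simps)
    have "P t < \<infinity>"
      using bound[OF assms(2,3) ab(1,2)] ab(3) by (auto intro: le_less_trans)
    moreover have "P t \<noteq> -\<infinity>"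
      unfolding P_def by (rule maximal_payoff_not_MInf)
    ultimately show ?thesis by auto
  qed
  show ?thesis
  proof (rule convex_onI)
    fix a x y :: real
    assume *: "0 < a" "a < 1" "x \<in> {-e..e}" "y \<in> {-e..e}"
    have "(1 - a) *\<^sub>R x + a *\<^sub>R y \<in> {-e..e}"
      using * convexD_alt[of "{-e..e}" x y a] by auto
    from fin[OF this] bound[OF fin[OF *(3)] fin[OF *(4)], of "1 - a" a] *(1,2)
    show "real_of_ereal (P ((1 - a) *\<^sub>R x + a *\<^sub>R y))
        \<le> (1 - a) * real_of_ereal (P x) + a * real_of_ereal (P y)"
      by (cases "P ((1 - a) *\<^sub>R x + a *\<^sub>R y)") auto
  qed auto
qed

text \<open>Envelope theorem: a unique maximiser \<open>L\<close> in the interior makes the maximal payoff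
  differentiable. Uniqueness and convexity make the payoff fall off linearly outside each
  \<open>\<delta>\<close>-neighbourhood of \<open>L\<close>, so that the maximum for slightly perturbed multipliers is, up to
  \<open>O(\<delta>)\<close> times the perturbation, attained at \<open>L\<close> itself.\<close>

lemma maximal_payoff_line_derivative:
  assumes L: "L \<in> interior I" and lam: "0 < lam"
    and strict: "\<And>y. y \<in> I \<Longrightarrow> y \<noteq> L \<Longrightarrow> y * z - lam * F y < L * z - lam * F L"
  shows "((\<lambda>t. real_of_ereal (maximal_payoff (lam + t * u) (z - t * v)))
            has_real_derivative - (L * v + F L * u)) (at 0)"
proof -
  define h where "h t = real_of_ereal (maximal_payoff (lam + t * u) (z - t * v))" for t
  define \<psi> where "\<psi> y = (L * z - lam * F L) - (y * z - lam * F y)" for y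
  define K where "K = \<bar>v + u * z / lam\<bar>"
  define D where "D = L * v + F L * u"
  have LI: "L \<in> I" using L interior_subset by blast
  have \<psi>0: "\<psi> y \<ge> 0" if "y \<in> I" for y
    using strict[OF that] by (cases "y = L") (auto simp: \<psi>_def)
  have \<psi>_scale: "\<psi> (L + a * (y - L)) \<le> a * \<psi> y" if "y \<in> I" "0 \<le> a" "a \<le> 1" for a y
  proof -
    have "F ((1 - a) *\<^sub>R L + a *\<^sub>R y) \<le> (1 - a) * F L + a * F y"
      using convex_onD[OF F_convex, of a L y] that LI by simp
    moreover have "(1 - a) *\<^sub>R L + a *\<^sub>R y = L + a * (y - L)" by (simp add: algebra_simps)
    ultimately have "lam * F (L + a * (y - L)) \<le> lam * ((1 - a) * F L + a * F y)"
      using lam by (intro mult_left_mono) auto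
    then show ?thesis by (simp add: \<psi>_def algebra_simps)
  qed
  obtain r where r: "0 < r" "cball L r \<subseteq> I"
    using L by (meson mem_interior_cball)
  have expand: "h t - (L * z - lam * F L) + t * D \<in> {0..\<bar>t\<bar> * (K * \<delta>)}"
    if \<delta>: "0 < \<delta>" "\<delta> \<le> r"
      and t: "\<bar>t\<bar> * \<bar>u\<bar> \<le> lam / 2" "2 * \<bar>t\<bar> * K * \<delta> \<le> min (\<psi> (L + \<delta>)) (\<psi> (L - \<delta>))" for t \<delta>
  proof -
    \<comment> \<open>Expansion around \<open>L\<close>: \<open>- D\<close> is the claimed slope, and \<open>\<psi> y\<close> the payoff forgone by \<open>y\<close> at \<open>t = 0\<close>.\<close>
    have payoff: "y * (z - t * v) - (lam + t * u) * F y
        = (L * z - lam * F L) - t * D - \<psi> y * (1 + t * u / lam) - t * (y - L) * (v + u * z / lam)" for y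
      using lam by (simp add: \<psi>_def D_def field_simps)
    have half: "1 / 2 \<le> 1 + t * u / lam"
    proof -
      have "\<bar>t * u\<bar> \<le> lam / 2" using t(1) by (simp add: abs_mult)
      then show ?thesis using lam by (simp add: field_simps)
    qed
    have upper: "y * (z - t * v) - (lam + t * u) * F y \<le> (L * z - lam * F L) - t * D + \<bar>t\<bar> * (K * \<delta>)"
      if y: "y \<in> I" for y
    proof -
      have 1: "\<psi> y / 2 \<le> \<psi> y * (1 + t * u / lam)"
        using mult_left_mono[OF half \<psi>0[OF y]] by simp
      have 2: "- (t * (y - L) * (v + u * z / lam)) \<le> \<bar>t\<bar> * K * \<bar>y - L\<bar>"
        unfolding K_def using abs_ge_minus_self[of "t * (y - L) * (v + u * z / lam)"]
        by (simp add: abs_mult mult_ac)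
      have "\<bar>t\<bar> * K * \<bar>y - L\<bar> - \<psi> y / 2 \<le> \<bar>t\<bar> * (K * \<delta>)"
      proof (cases "\<bar>y - L\<bar> \<le> \<delta>")
        \<comment> \<open>Near \<open>L\<close> the perturbation is small by itself; far from \<open>L\<close> the linear growth of \<open>\<psi>\<close> beats it.\<close>
        case True
        have "\<bar>t\<bar> * K * \<bar>y - L\<bar> \<le> \<bar>t\<bar> * K * \<delta>"
          using True by (intro mult_left_mono) (auto simp: K_def)
        then show ?thesis using \<psi>0[OF y] by (simp add: mult.assoc)
      next
        case False
        define a where "a = \<delta> / \<bar>y - L\<bar>"
        have a: "0 \<le> a" "a \<le> 1" "a * \<bar>y - L\<bar> = \<delta>" "0 < \<bar>y - L\<bar>"
          using False \<delta> by (auto simp: a_def)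
        have "a * (y - L) = \<delta> \<or> a * (y - L) = - \<delta>"
          using a by (cases "y < L") (auto simp: algebra_simps)
        then have "min (\<psi> (L + \<delta>)) (\<psi> (L - \<delta>)) \<le> a * \<psi> y"
          using \<psi>_scale[OF y a(1,2)] by auto
        with t(2) have "2 * \<bar>t\<bar> * K * \<delta> \<le> a * \<psi> y" by linarith
        then have "(2 * \<bar>t\<bar> * K * \<delta>) * \<bar>y - L\<bar> \<le> a * \<psi> y * \<bar>y - L\<bar>"
          by (rule mult_right_mono) simp
        also have "\<dots> = \<delta> * \<psi> y" using a(3) by (metis mult.commute mult.assoc)
        finally have "\<delta> * (2 * \<bar>t\<bar> * K * \<bar>y - L\<bar>) \<le> \<delta> * \<psi> y" by (simp add: mult_ac)
        then have "2 * \<bar>t\<bar> * K * \<bar>y - L\<bar> \<le> \<psi> y" using \<delta> by simp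
        moreover have "0 \<le> \<bar>t\<bar> * (K * \<delta>)" using \<delta> by (simp add: K_def)
        ultimately show ?thesis by simp
      qed
      with 1 2 show ?thesis unfolding payoff by simp
    qed
    have "maximal_payoff (lam + t * u) (z - t * v) \<le> ereal ((L * z - lam * F L) - t * D + \<bar>t\<bar> * (K * \<delta>))"
      by (rule maximal_payoff_least) (use upper in auto)
    moreover have "ereal ((L * z - lam * F L) - t * D) \<le> maximal_payoff (lam + t * u) (z - t * v)"
      using maximal_payoff_upper[OF LI, of "z - t * v" "lam + t * u"] payoff[of L] by (simp add: \<psi>_def)
    ultimately show ?thesis
      unfolding h_def by (cases "maximal_payoff (lam + t * u) (z - t * v)") auto
  qed
  have small: "\<exists>s>0. \<forall>t. \<bar>t\<bar> < s \<longrightarrow> h t - (L * z - lam * F L) + t * D \<in> {0..\<bar>t\<bar> * (K * \<delta>)}"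
    if \<delta>: "0 < \<delta>" "\<delta> \<le> r" for \<delta>
  proof -
    define \<eta> where "\<eta> = min (\<psi> (L + \<delta>)) (\<psi> (L - \<delta>))"
    have "L + \<delta> \<in> I" "L - \<delta> \<in> I" using r(2) \<delta> by (auto simp: subset_iff dist_real_def)
    then have \<eta>: "0 < \<eta>"
      using strict[of "L + \<delta>"] strict[of "L - \<delta>"] \<delta> by (auto simp: \<eta>_def \<psi>_def)
    define s where "s = min (lam / (2 * (\<bar>u\<bar> + 1))) (\<eta> / (2 * (K * \<delta> + 1)))"
    have K: "0 \<le> K * \<delta>" using \<delta> by (simp add: K_def)
    have "0 < s" using lam \<eta> K by (simp add: s_def)
    moreover have "h t - (L * z - lam * F L) + t * D \<in> {0..\<bar>t\<bar> * (K * \<delta>)}" if "\<bar>t\<bar> < s" for t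
    proof (rule expand[OF \<delta>])
      have "\<bar>t\<bar> * (2 * (\<bar>u\<bar> + 1)) \<le> lam" "\<bar>t\<bar> * (2 * (K * \<delta> + 1)) \<le> \<eta>"
        using that K unfolding s_def by (simp_all add: pos_less_divide_eq)
      moreover have "\<bar>t\<bar> * (2 * (\<bar>u\<bar> + 1)) = 2 * (\<bar>t\<bar> * \<bar>u\<bar>) + 2 * \<bar>t\<bar>"
          "\<bar>t\<bar> * (2 * (K * \<delta> + 1)) = 2 * \<bar>t\<bar> * K * \<delta> + 2 * \<bar>t\<bar>"
        by (simp_all add: algebra_simps)
      ultimately show "\<bar>t\<bar> * \<bar>u\<bar> \<le> lam / 2" "2 * \<bar>t\<bar> * K * \<delta> \<le> min (\<psi> (L + \<delta>)) (\<psi> (L - \<delta>))"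
        unfolding \<eta>_def[symmetric] by linarith+
    qed
    ultimately show ?thesis by blast
  qed
  have h0: "h 0 = L * z - lam * F L"
  proof -
    from small[OF r(1) order_refl] obtain s where "0 < s"
      and "\<forall>t. \<bar>t\<bar> < s \<longrightarrow> h t - (L * z - lam * F L) + t * D \<in> {0..\<bar>t\<bar> * (K * r)}" by blast
    from this(2)[rule_format, of 0] this(1) show ?thesis by simp
  qed
  have "(\<lambda>t. (h (0 + t) - h 0) / t) \<midarrow>0\<rightarrow> - D"
  proof (rule LIM_I)
    fix e :: real assume e: "0 < e"
    define \<delta> where "\<delta> = min r (e / (2 * (K + 1)))"
    have K: "0 \<le> K" by (simp add: K_def)
    have \<delta>: "0 < \<delta>" "\<delta> \<le> r" using r e K by (auto simp: \<delta>_def)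
    have "K * \<delta> \<le> K * (e / (2 * (K + 1)))"
      using K by (intro mult_left_mono) (auto simp: \<delta>_def)
    also have "\<dots> < e" using K e by (simp add: field_simps add_nonneg_pos)
    finally have Ke: "K * \<delta> < e" .
    from small[OF \<delta>] obtain s where s: "0 < s"
      and close: "\<And>t. \<bar>t\<bar> < s \<Longrightarrow> h t - h 0 + t * D \<in> {0..\<bar>t\<bar> * (K * \<delta>)}" unfolding h0 by auto
    have "norm ((h (0 + t) - h 0) / t - - D) < e" if t: "t \<noteq> 0" "\<bar>t\<bar> < s" for t
    proof -
      have "(h (0 + t) - h 0) / t - - D = (h t - h 0 + t * D) / t" using t by (simp add: field_simps)
      also have "norm \<dots> \<le> K * \<delta>"
        using close[OF t(2)] t by (simp add: abs_mult field_simps)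
      finally show ?thesis using Ke by simp
    qed
    with s show "\<exists>s>0. \<forall>t. t \<noteq> 0 \<and> norm (t - 0) < s \<longrightarrow> norm ((h (0 + t) - h 0) / t - - D) < e" by auto
  qed
  then show ?thesis by (simp add: DERIV_def h_def D_def)
qed

end

section \<open>First-order conditions at the optimal likelihood\<close>

locale divergence_model = divergence_generator f + prob_space M
  for f :: "real \<Rightarrow> ereal" and M :: "'w measure"
begin

lemma payoff_ereal:
  assumes "0 < lam"
  shows "ereal y * (ereal x - ereal \<mu>) - ereal lam * f y
    = (if y \<in> I then ereal (y * (x - \<mu>) - lam * F y) else -\<infinity>)"
proof (cases "y \<in> I")
  case True
  with f_finite obtain r where "f y = ereal r" by blast
  with True show ?thesis by simp
next
  case False
  with assms f_outside show ?thesis by simp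
qed

text \<open>A likelihood that maximises the integrated payoff maximises the payoff pointwise: otherwise
  replacing it by a better constant on the set where that constant is better would raise the integral.
  Likewise a second pointwise maximiser would, by convexity, yield a rational one on a set of positive
  measure, and thereby a second maximising likelihood. The objective is not \<open>-\<infinity>\<close>, since then all
  likelihoods would be optimal.\<close>

lemma optimal_likelihood_pointwise:
  assumes X[measurable]: "X \<in> borel_measurable M" and lam: "0 < lam"
    and fin: "\<bar>ext_integral M (\<lambda>\<omega>. maximal_payoff lam (X \<omega> - \<mu>))\<bar> \<noteq> \<infinity>"
    and opt: "optimal_likelihood f M (\<lambda>\<omega>. ereal (X \<omega>)) lam \<mu> L"
  shows "AE \<omega> in M. L \<omega> \<in> I \<and>
    (\<forall>y\<in>I. y \<noteq> L \<omega> \<longrightarrow> y * (X \<omega> - \<mu>) - lam * F y < L \<omega> * (X \<omega> - \<mu>) - lam * F (L \<omega>))"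
proof -
  define g where "g \<omega> = real_of_ereal (maximal_payoff lam (X \<omega> - \<mu>))" for \<omega>
  have "(\<lambda>\<omega>. maximal_payoff lam (X \<omega> - \<mu>)) \<in> borel_measurable M" by simp
  from ext_integral_finite[OF this fin]
  have g_fin: "AE \<omega> in M. \<bar>maximal_payoff lam (X \<omega> - \<mu>)\<bar> \<noteq> \<infinity>" and g_int: "integrable M g"
    by (simp_all add: g_def[abs_def])
  define pay where "pay y \<omega> = y * (X \<omega> - \<mu>) - lam * F y" for y \<omega>
  have g_upper: "AE \<omega> in M. \<forall>y\<in>I. pay y \<omega> \<le> g \<omega>"
    using g_fin
  proof eventually_elim
    case (elim \<omega>)
    show ?case
    proof
      fix y assume "y \<in> I"
      from maximal_payoff_upper[OF this, of "X \<omega> - \<mu>" lam] elim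
      show "pay y \<omega> \<le> g \<omega>"
        unfolding g_def pay_def by (cases "maximal_payoff lam (X \<omega> - \<mu>)") auto
    qed
  qed
  define J where "J = likelihood_objective f M (\<lambda>\<omega>. ereal (X \<omega>)) lam \<mu>"
  have J: "J L' = ext_integral M (\<lambda>\<omega>. if L' \<omega> \<in> I then ereal (pay (L' \<omega>) \<omega>) else -\<infinity>)" for L'
    unfolding J_def likelihood_objective_def payoff_ereal[OF lam] pay_def ..
  from opt have Lik: "L \<in> likelihoods M"
    and max: "J L = (SUP L'\<in>likelihoods M. J L')"
    and uniq: "\<And>L'. L' \<in> likelihoods M \<Longrightarrow> J L' = J L \<Longrightarrow> AE \<omega> in M. L' \<omega> = L \<omega>"
    by (auto simp: optimal_likelihood_def J_def)
  then have L[measurable]: "L \<in> borel_measurable M" and L0: "\<And>\<omega>. \<omega> \<in> space M \<Longrightarrow> 0 \<le> L \<omega>"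
    by (auto simp: likelihoods_def)
  have best: "J L' \<le> J L" if "L' \<in> likelihoods M" for L'
    unfolding max using that by (rule SUP_upper)
  have "J L \<noteq> -\<infinity>"
  proof
    assume MInf: "J L = -\<infinity>"
    have const: "(\<lambda>_. c) \<in> likelihoods M" if "0 \<le> c" for c
      using that by (simp add: likelihoods_def)
    have "AE \<omega> in M. 0 = L \<omega>" "AE \<omega> in M. 1 = L \<omega>"
      using best[OF const] MInf by (intro uniq const; simp)+
    then have "AE \<omega> in M. False" by eventually_elim simp
    then show False by simp
  qed
  moreover have "J L \<le> ext_integral M (\<lambda>\<omega>. ereal (g \<omega>))"
    unfolding J using g_upper by (intro ext_integral_mono_AE) (auto elim!: eventually_mono)
  ultimately have JL: "\<bar>J L\<bar> \<noteq> \<infinity>"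
    unfolding ext_integral_real[OF g_int] by auto
  have [measurable]: "(\<lambda>\<omega>. pay (L' \<omega>) \<omega>) \<in> borel_measurable M" if [measurable]: "L' \<in> borel_measurable M" for L'
    unfolding pay_def by simp
  have "(\<lambda>\<omega>. if L \<omega> \<in> I then ereal (pay (L \<omega>) \<omega>) else -\<infinity>) \<in> borel_measurable M" by simp
  note fin_L = ext_integral_finite[OF this JL[unfolded J]]
  from fin_L(1) have LI: "AE \<omega> in M. L \<omega> \<in> I"
    by eventually_elim (auto split: if_splits)
  have J_real: "J L' = ereal (\<integral>\<omega>. pay (L' \<omega>) \<omega> \<partial>M)"
    if "AE \<omega> in M. L' \<omega> \<in> I" "integrable M (\<lambda>\<omega>. pay (L' \<omega>) \<omega>)" for L'
    unfolding J ext_integral_real[OF that(2), symmetric]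
    using that(1) by (intro ext_integral_cong_AE) (auto elim!: eventually_mono)
  have k_int: "integrable M (\<lambda>\<omega>. pay (L \<omega>) \<omega>)"
    by (rule iffD1[OF integrable_cong_AE fin_L(2)])
       (use LI in \<open>auto elim!: eventually_mono\<close>)
  have improve: "AE \<omega> in M. pay y \<omega> \<le> pay (L \<omega>) \<omega>" if y: "y \<in> I" for y
  proof -
    define L' where "L' \<omega> = (if pay (L \<omega>) \<omega> < pay y \<omega> then y else L \<omega>)" for \<omega>
    have [measurable]: "L' \<in> borel_measurable M" unfolding L'_def pay_def by measurable
    have L': "L' \<in> likelihoods M"
      using I_nonneg[OF y] L0 by (auto simp: likelihoods_def L'_def)
    have L'I: "AE \<omega> in M. L' \<omega> \<in> I"
      using LI by eventually_elim (use y in \<open>auto simp: L'_def\<close>)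
    have ge: "pay (L \<omega>) \<omega> \<le> pay (L' \<omega>) \<omega>" for \<omega> by (simp add: L'_def)
    have int: "integrable M (\<lambda>\<omega>. pay (L' \<omega>) \<omega>)"
    proof (rule Bochner_Integration.integrable_bound)
      show "integrable M (\<lambda>\<omega>. \<bar>g \<omega>\<bar> + \<bar>pay (L \<omega>) \<omega>\<bar>)" using g_int k_int by auto
      show "AE \<omega> in M. norm (pay (L' \<omega>) \<omega>) \<le> norm (\<bar>g \<omega>\<bar> + \<bar>pay (L \<omega>) \<omega>\<bar>)"
        using g_upper L'I
      proof eventually_elim
        case (elim \<omega>)
        with ge[of \<omega>] have "pay (L \<omega>) \<omega> \<le> pay (L' \<omega>) \<omega>" "pay (L' \<omega>) \<omega> \<le> g \<omega>" by auto
        then show ?case by simp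
      qed
    qed simp
    have "(\<integral>\<omega>. pay (L' \<omega>) \<omega> \<partial>M) \<le> (\<integral>\<omega>. pay (L \<omega>) \<omega> \<partial>M)"
      using best[OF L'] J_real[OF L'I int] J_real[OF LI k_int] by simp
    moreover have "(\<integral>\<omega>. pay (L \<omega>) \<omega> \<partial>M) \<le> (\<integral>\<omega>. pay (L' \<omega>) \<omega> \<partial>M)"
      by (rule integral_mono[OF k_int int ge])
    ultimately have "(\<integral>\<omega>. pay (L' \<omega>) \<omega> - pay (L \<omega>) \<omega> \<partial>M) = 0"
      using int k_int by simp
    then have "AE \<omega> in M. pay (L' \<omega>) \<omega> - pay (L \<omega>) \<omega> = 0"
      by (subst (asm) integral_nonneg_eq_0_iff_AE) (use int k_int ge in auto)
    then show ?thesis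
      by eventually_elim (auto simp: L'_def split: if_splits)
  qed
  have unique: "AE \<omega> in M. pay y \<omega> = pay (L \<omega>) \<omega> \<longrightarrow> y = L \<omega>" if y: "y \<in> I" for y
  proof -
    define L' where "L' \<omega> = (if pay (L \<omega>) \<omega> \<le> pay y \<omega> then y else L \<omega>)" for \<omega>
    have "(\<lambda>\<omega>. pay y \<omega>) \<in> borel_measurable M" "(\<lambda>\<omega>. pay (L \<omega>) \<omega>) \<in> borel_measurable M"
      unfolding pay_def by simp_all
    then have "L' \<in> borel_measurable M"
      unfolding L'_def by (intro measurable_If borel_measurable_le) simp_all
    then have L': "L' \<in> likelihoods M"
      using I_nonneg[OF y] L0 by (auto simp: likelihoods_def L'_def)
    have "J L' = J L"
      unfolding J
    proof (rule ext_integral_cong_AE)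
      show "AE \<omega> in M. (if L' \<omega> \<in> I then ereal (pay (L' \<omega>) \<omega>) else -\<infinity>)
          = (if L \<omega> \<in> I then ereal (pay (L \<omega>) \<omega>) else -\<infinity>)"
        using LI improve[OF y] by eventually_elim (use y in \<open>auto simp: L'_def\<close>)
    qed
    from uniq[OF L' this] show ?thesis
      by eventually_elim (auto simp: L'_def)
  qed
  obtain e :: "nat \<Rightarrow> real" where e: "range e \<subseteq> I"
    and dense: "\<And>lam z b y. \<forall>k. e k * z - lam * F (e k) \<le> b \<Longrightarrow> y \<in> I \<Longrightarrow> y * z - lam * F y \<le> b"
    using countable_determining_set by blast
  have "AE \<omega> in M. \<forall>k. pay (e k) \<omega> \<le> pay (L \<omega>) \<omega>"
    unfolding AE_all_countable using e improve by auto
  moreover have "AE \<omega> in M. \<forall>r\<in>{r\<in>\<rat>. r \<in> I}. pay r \<omega> = pay (L \<omega>) \<omega> \<longrightarrow> r = L \<omega>"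
    using unique by (subst AE_ball_countable) (auto intro: countable_subset[OF _ countable_rat])
  ultimately show ?thesis
    using LI
  proof eventually_elim
    case (elim \<omega>)
    have le: "pay y \<omega> \<le> pay (L \<omega>) \<omega>" if "y \<in> I" for y
      using dense[of "X \<omega> - \<mu>" lam "pay (L \<omega>) \<omega>" y] elim(1) that unfolding pay_def by auto
    have "pay y \<omega> < pay (L \<omega>) \<omega>" if y: "y \<in> I" "y \<noteq> L \<omega>" for y
    proof (rule ccontr)
      assume "\<not> pay y \<omega> < pay (L \<omega>) \<omega>"
      with le[OF y(1)] have eq: "pay y \<omega> = pay (L \<omega>) \<omega>" by simp
      obtain r where r: "r \<in> \<rat>" "min y (L \<omega>) < r" "r < max y (L \<omega>)"
        using Rats_dense_in_real[of "min y (L \<omega>)" "max y (L \<omega>)"] y(2) by (metis max_def min_def not_le order_less_le)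
      define a where "a = (r - L \<omega>) / (y - L \<omega>)"
      have "a * (y - L \<omega>) = r - L \<omega>" using y(2) by (simp add: a_def)
      moreover have "0 \<le> a" "a \<le> 1"
        using r y(2) by (auto simp: a_def zero_le_divide_iff divide_le_eq min_def max_def split: if_splits)
      ultimately have a: "0 \<le> a" "a \<le> 1" "r = (1 - a) * L \<omega> + a * y"
        by (auto simp: algebra_simps)
      have rI: "r \<in> I"
        using convexD_alt[OF I_convex elim(3) y(1) a(1,2)] a(3) by simp
      have "F r \<le> (1 - a) * F (L \<omega>) + a * F y"
        using convex_onD[OF F_convex a(1,2) elim(3) y(1)] a(3) by simp
      then have "lam * F r \<le> lam * ((1 - a) * F (L \<omega>) + a * F y)"
        using lam by simp
      moreover have "(1 - a) * pay (L \<omega>) \<omega> + a * pay y \<omega>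
          = r * (X \<omega> - \<mu>) - lam * ((1 - a) * F (L \<omega>) + a * F y)"
        unfolding a(3) pay_def by (simp add: algebra_simps)
      moreover have "(1 - a) * pay (L \<omega>) \<omega> + a * pay y \<omega> = pay (L \<omega>) \<omega>"
        unfolding eq by (simp add: algebra_simps)
      ultimately have "pay (L \<omega>) \<omega> \<le> pay r \<omega>" by (simp add: pay_def)
      with le[OF rI] have "pay r \<omega> = pay (L \<omega>) \<omega>" by simp
      with elim(2) r(1) rI have "r = L \<omega>" by auto
      with r show False by (auto simp: min_def max_def split: if_splits)
    qed
    with elim(3) show ?case by (auto simp: pay_def)
  qed
qed

lemma deriv_at_payoff_maximiser:
  assumes L: "L \<in> interior I" and lam: "0 < lam" and diff: "F differentiable (at L)"
    and max: "\<And>y. y \<in> I \<Longrightarrow> y * z - lam * F y \<le> L * z - lam * F L"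
  shows "deriv F L = z / lam"
proof -
  have der: "(F has_real_derivative deriv F L) (at L)"
    using diff by (simp add: DERIV_deriv_iff_real_differentiable)
  then have "((\<lambda>y. y * z - lam * F y) has_real_derivative z - lam * deriv F L) (at L)"
    by (auto intro!: derivative_eq_intros)
  moreover obtain d where d: "0 < d" "ball L d \<subseteq> I"
    using L by (meson mem_interior)
  moreover have "\<forall>y. \<bar>L - y\<bar> < d \<longrightarrow> y * z - lam * F y \<le> L * z - lam * F L"
    using d max by (auto simp: subset_iff dist_real_def)
  ultimately have "z - lam * deriv F L = 0"
    using DERIV_local_max by blast
  then show ?thesis using lam by (simp add: field_simps)
qed

text \<open>Along a line of multipliers the integrand of the dual loss is convex and has an almost everywhere known
  derivative, so its integral is stationary at a minimum. The direction \<open>(0, 1)\<close> gives total mass one, and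
  \<open>(1, 0)\<close> says that the divergence constraint is active.\<close>

lemma dual_loss_stationary:
  assumes X[measurable]: "X \<in> borel_measurable M" and lam: "0 < lam" and one: "1 \<in> I"
    and L[measurable]: "L \<in> borel_measurable M"
    and L_int: "AE \<omega> in M. L \<omega> \<in> interior I"
    and strict: "AE \<omega> in M. \<forall>y\<in>I. y \<noteq> L \<omega> \<longrightarrow>
      y * (X \<omega> - \<mu>) - lam * F y < L \<omega> * (X \<omega> - \<mu>) - lam * F (L \<omega>)"
    and e: "0 < e"
    and nonneg: "\<And>t. \<bar>t\<bar> \<le> e \<Longrightarrow> 0 \<le> lam + t * u"
    and fin: "\<And>t. \<bar>t\<bar> \<le> e \<Longrightarrow> \<bar>dual_loss f \<rho> M (\<lambda>\<omega>. ereal (X \<omega>)) (lam + t * u) (\<mu> + t * v)\<bar> \<noteq> \<infinity>"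
    and min: "\<And>t. \<bar>t\<bar> \<le> e \<Longrightarrow> dual_loss f \<rho> M (\<lambda>\<omega>. ereal (X \<omega>)) lam \<mu>
      \<le> dual_loss f \<rho> M (\<lambda>\<omega>. ereal (X \<omega>)) (lam + t * u) (\<mu> + t * v)"
  shows "integrable M (\<lambda>\<omega>. L \<omega> * v + F (L \<omega>) * u)"
    and "(\<integral>\<omega>. L \<omega> * v + F (L \<omega>) * u \<partial>M) = u * (\<rho> + F 1) + v"
proof -
  define P where "P t \<omega> = maximal_payoff (lam + t * u) (X \<omega> - \<mu> - t * v)" for t \<omega>
  define G where "G t \<omega> = real_of_ereal (P t \<omega>)" for t \<omega>
  define \<kappa> where "\<kappa> \<omega> = - (L \<omega> * v + F (L \<omega>) * u)" for \<omega>
  have P_meas: "P t \<in> borel_measurable M" for t unfolding P_def by simp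
  have D: "dual_loss f \<rho> M (\<lambda>\<omega>. ereal (X \<omega>)) (lam + t * u) (\<mu> + t * v)
      = ereal ((lam + t * u) * (\<rho> + F 1) + (\<mu> + t * v)) + ext_integral M (P t)" if "\<bar>t\<bar> \<le> e" for t
    using dual_loss_real[OF nonneg[OF that] one, of \<rho> M X "\<mu> + t * v"]
    by (simp add: P_def[abs_def] diff_diff_eq)
  have P_fin: "\<bar>ext_integral M (P t)\<bar> \<noteq> \<infinity>" if "\<bar>t\<bar> \<le> e" for t
    using fin[OF that] unfolding D[OF that] by (cases "ext_integral M (P t)") auto
  note P_real = ext_integral_finite[OF P_meas P_fin, folded G_def]
  have "integrable M \<kappa> \<and> (\<integral>\<omega>. \<kappa> \<omega> \<partial>M) = - (u * (\<rho> + F 1) + v)"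
  proof (rule integral_convex_stationary[OF e])
    show "integrable M (G t)" if "\<bar>t\<bar> \<le> e" for t
      using P_real(2)[OF that] by (simp add: G_def[abs_def])
    have "\<bar>e\<bar> \<le> e" "\<bar>- e\<bar> \<le> e" using e by auto
    from P_real(1)[OF this(1)] P_real(1)[OF this(2)]
    show "AE \<omega> in M. convex_on {-e..e} (\<lambda>t. G t \<omega>)"
    proof eventually_elim
      case (elim \<omega>)
      then show ?case
        unfolding G_def P_def by (rule maximal_payoff_line_convex)
    qed
    show "AE \<omega> in M. ((\<lambda>t. G t \<omega>) has_real_derivative \<kappa> \<omega>) (at 0)"
      using L_int strict
    proof eventually_elim
      case (elim \<omega>)
      then show ?case
        unfolding G_def P_def \<kappa>_def by (intro maximal_payoff_line_derivative lam) auto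
    qed
    show "\<kappa> \<in> borel_measurable M" unfolding \<kappa>_def by simp
    show "(\<integral>\<omega>. G 0 \<omega> \<partial>M) \<le> (u * (\<rho> + F 1) + v) * t + (\<integral>\<omega>. G t \<omega> \<partial>M)" if t: "\<bar>t\<bar> \<le> e" for t
    proof -
      have 0: "\<bar>0\<bar> \<le> e" using e by simp
      have "ereal (lam * (\<rho> + F 1) + \<mu> + (\<integral>\<omega>. G 0 \<omega> \<partial>M))
          \<le> ereal ((lam + t * u) * (\<rho> + F 1) + (\<mu> + t * v) + (\<integral>\<omega>. G t \<omega> \<partial>M))"
        using min[OF t] D[OF 0] D[OF t] P_real(3)[OF 0] P_real(3)[OF t] by (simp add: G_def)
      then show ?thesis by (simp add: algebra_simps)
    qed
  qed
  then have "integrable M (\<lambda>\<omega>. - \<kappa> \<omega>)" "(\<integral>\<omega>. - \<kappa> \<omega> \<partial>M) = u * (\<rho> + F 1) + v"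
    by simp_all
  then show "integrable M (\<lambda>\<omega>. L \<omega> * v + F (L \<omega>) * u)"
      "(\<integral>\<omega>. L \<omega> * v + F (L \<omega>) * u \<partial>M) = u * (\<rho> + F 1) + v"
    by (simp_all add: \<kappa>_def add.commute)
qed

end

section \<open>Strong duality: Lagrange multipliers\<close>

locale interior_divergence_model = divergence_model f M
  for f :: "real \<Rightarrow> ereal" and M :: "'w measure" +
  fixes c \<rho> :: real
  assumes one_interior: "1 \<in> interior (eff_dom f)"
    and subgradient: "\<And>y. y \<in> eff_dom f \<Longrightarrow> real_of_ereal (f 1) + c * (y - 1) \<le> real_of_ereal (f y)"
    and rho_pos: "0 < \<rho>"
begin

\<comment> \<open>This rule would hide the absolute value of \<open>F\<close> inside the conversion from the extended reals.\<close>
declare abs_real_of_ereal [simp del]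

lemma one_in_I: "1 \<in> I"
  using one_interior interior_subset by blast

text \<open>The likelihoods for which mass, divergence and expected loss all are finite. The separation
  argument needs all three numbers, and this class may be empty.\<close>

definition admissible :: "('w \<Rightarrow> real) \<Rightarrow> ('w \<Rightarrow> real) set" where
  "admissible X = {L \<in> borel_measurable M. (\<forall>\<omega>\<in>space M. L \<omega> \<in> I) \<and> integrable M L \<and>
     integrable M (\<lambda>\<omega>. F (L \<omega>)) \<and> integrable M (\<lambda>\<omega>. L \<omega> * X \<omega>)}"

lemma admissibleD:
  assumes "L \<in> admissible X"
  shows "L \<in> borel_measurable M" "\<And>\<omega>. \<omega> \<in> space M \<Longrightarrow> L \<omega> \<in> I" "integrable M L"
    "integrable M (\<lambda>\<omega>. F (L \<omega>))" "integrable M (\<lambda>\<omega>. L \<omega> * X \<omega>)"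
  using assms by (auto simp: admissible_def)

lemma admissible_payoff_integrable:
  assumes "L \<in> admissible X"
  shows "integrable M (\<lambda>\<omega>. L \<omega> * (X \<omega> - \<mu>) - lam * F (L \<omega>))"
    and "(\<integral>\<omega>. L \<omega> * (X \<omega> - \<mu>) - lam * F (L \<omega>) \<partial>M)
      = (\<integral>\<omega>. L \<omega> * X \<omega> \<partial>M) - \<mu> * (\<integral>\<omega>. L \<omega> \<partial>M) - lam * (\<integral>\<omega>. F (L \<omega>) \<partial>M)"
proof -
  have "(\<lambda>\<omega>. L \<omega> * (X \<omega> - \<mu>) - lam * F (L \<omega>)) = (\<lambda>\<omega>. L \<omega> * X \<omega> - \<mu> * L \<omega> - lam * F (L \<omega>))"
    by (auto simp: algebra_simps)
  then show "integrable M (\<lambda>\<omega>. L \<omega> * (X \<omega> - \<mu>) - lam * F (L \<omega>))"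
    "(\<integral>\<omega>. L \<omega> * (X \<omega> - \<mu>) - lam * F (L \<omega>) \<partial>M)
      = (\<integral>\<omega>. L \<omega> * X \<omega> \<partial>M) - \<mu> * (\<integral>\<omega>. L \<omega> \<partial>M) - lam * (\<integral>\<omega>. F (L \<omega>) \<partial>M)"
    using admissibleD[OF assms] by simp_all
qed

text \<open>Overwriting an admissible likelihood by a constant where the loss is bounded is the means both of
  improving it pointwise and of reaching strictly feasible divergences.\<close>

lemma admissible_patch:
  assumes X[measurable]: "X \<in> borel_measurable M" and L: "L \<in> admissible X" and y: "y \<in> I"
    and B[measurable]: "B \<in> sets M" and bound: "\<And>\<omega>. \<omega> \<in> B \<Longrightarrow> \<bar>X \<omega>\<bar> \<le> b"
  shows "(\<lambda>\<omega>. if \<omega> \<in> B then y else L \<omega>) \<in> admissible X"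
proof -
  note [measurable] = admissibleD(1)[OF L]
  note int = admissibleD(3,4,5)[OF L]
  have "integrable M (\<lambda>\<omega>. if \<omega> \<in> B then y else L \<omega>)"
    by (rule Bochner_Integration.integrable_bound[where f="\<lambda>\<omega>. \<bar>y\<bar> + \<bar>L \<omega>\<bar>"]) (use int in auto)
  moreover have "integrable M (\<lambda>\<omega>. F (if \<omega> \<in> B then y else L \<omega>))"
    by (rule Bochner_Integration.integrable_bound[where f="\<lambda>\<omega>. \<bar>F y\<bar> + \<bar>F (L \<omega>)\<bar>"]) (use int in auto)
  moreover have "integrable M (\<lambda>\<omega>. (if \<omega> \<in> B then y else L \<omega>) * X \<omega>)"
  proof (rule Bochner_Integration.integrable_bound[where f="\<lambda>\<omega>. \<bar>y\<bar> * \<bar>b\<bar> + \<bar>L \<omega> * X \<omega>\<bar>"])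
    show "AE \<omega> in M. norm ((if \<omega> \<in> B then y else L \<omega>) * X \<omega>) \<le> norm (\<bar>y\<bar> * \<bar>b\<bar> + \<bar>L \<omega> * X \<omega>\<bar>)"
    proof (rule AE_I2)
      fix \<omega>
      have "\<bar>y\<bar> * \<bar>X \<omega>\<bar> \<le> \<bar>y\<bar> * \<bar>b\<bar>" if "\<omega> \<in> B"
        using bound[OF that] by (intro mult_left_mono) auto
      then show "norm ((if \<omega> \<in> B then y else L \<omega>) * X \<omega>) \<le> norm (\<bar>y\<bar> * \<bar>b\<bar> + \<bar>L \<omega> * X \<omega>\<bar>)"
        by (auto simp: abs_mult intro: add_increasing2)
    qed
  qed (use int in auto)
  ultimately show ?thesis
    using y admissibleD(2)[OF L] by (auto simp: admissible_def)
qed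

lemma admissible_convex:
  assumes L: "L \<in> admissible X" "L' \<in> admissible X" and a: "0 \<le> a" "0 \<le> b" "a + b = 1"
  shows "(\<lambda>\<omega>. a * L \<omega> + b * L' \<omega>) \<in> admissible X"
    and "(\<integral>\<omega>. F (a * L \<omega> + b * L' \<omega>) \<partial>M) \<le> a * (\<integral>\<omega>. F (L \<omega>) \<partial>M) + b * (\<integral>\<omega>. F (L' \<omega>) \<partial>M)"
proof -
  note [measurable] = admissibleD(1)[OF L(1)] admissibleD(1)[OF L(2)]
  note int = admissibleD(3,4,5)[OF L(1)] admissibleD(3,4,5)[OF L(2)]
  have I: "a * L \<omega> + b * L' \<omega> \<in> I" if "\<omega> \<in> space M" for \<omega>
    using convexD[OF I_convex _ _ a] admissibleD(2)[OF L(1) that] admissibleD(2)[OF L(2) that] by simp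
  have le: "F (a * L \<omega> + b * L' \<omega>) \<le> a * F (L \<omega>) + b * F (L' \<omega>)" if "\<omega> \<in> space M" for \<omega>
    using F_convex admissibleD(2)[OF L(1) that] admissibleD(2)[OF L(2) that] a
    by (auto simp: convex_on_def)
  have "integrable M (\<lambda>\<omega>. F (a * L \<omega> + b * L' \<omega>))"
  proof (rule Bochner_Integration.integrable_bound)
    show "integrable M (\<lambda>\<omega>. \<bar>a * F (L \<omega>) + b * F (L' \<omega>)\<bar> + \<bar>F 1 + c * (a * L \<omega> + b * L' \<omega> - 1)\<bar>)"
      using int by auto
    show "AE \<omega> in M. norm (F (a * L \<omega> + b * L' \<omega>))
      \<le> norm (\<bar>a * F (L \<omega>) + b * F (L' \<omega>)\<bar> + \<bar>F 1 + c * (a * L \<omega> + b * L' \<omega> - 1)\<bar>)"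
    proof (rule AE_I2)
      fix \<omega> assume "\<omega> \<in> space M"
      from le[OF this] subgradient[OF I[OF this]]
      show "norm (F (a * L \<omega> + b * L' \<omega>))
        \<le> norm (\<bar>a * F (L \<omega>) + b * F (L' \<omega>)\<bar> + \<bar>F 1 + c * (a * L \<omega> + b * L' \<omega> - 1)\<bar>)"
        by (simp add: abs_le_iff) (auto simp: abs_if split: if_splits)
    qed
  qed simp
  moreover have "integrable M (\<lambda>\<omega>. (a * L \<omega> + b * L' \<omega>) * X \<omega>)"
    using int by (simp add: distrib_right mult.assoc)
  ultimately show adm: "(\<lambda>\<omega>. a * L \<omega> + b * L' \<omega>) \<in> admissible X"
    using int I by (auto simp: admissible_def)
  have "(\<integral>\<omega>. F (a * L \<omega> + b * L' \<omega>) \<partial>M) \<le> (\<integral>\<omega>. a * F (L \<omega>) + b * F (L' \<omega>) \<partial>M)"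
    using le admissibleD(4)[OF adm] int by (intro integral_mono) auto
  then show "(\<integral>\<omega>. F (a * L \<omega> + b * L' \<omega>) \<partial>M)
      \<le> a * (\<integral>\<omega>. F (L \<omega>) \<partial>M) + b * (\<integral>\<omega>. F (L' \<omega>) \<partial>M)"
    using int by simp
qed

text \<open>Moving the supremum inside the integral. A likelihood is improved step by step, on the set where
  the loss is at most \<open>k\<close>, by constants from a countable determining set; each constant recurs
  infinitely often, so in the limit the pointwise supremum is reached, and monotone convergence applies.\<close>

lemma integral_maximal_payoff_le:
  assumes X[measurable]: "X \<in> borel_measurable M" and L0: "L0 \<in> admissible X"
    and bound: "\<And>L. L \<in> admissible X \<Longrightarrow> (\<integral>\<omega>. L \<omega> * (X \<omega> - \<mu>) - lam * F (L \<omega>) \<partial>M) \<le> b"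
  shows "ext_integral M (\<lambda>\<omega>. maximal_payoff lam (X \<omega> - \<mu>)) \<le> ereal b"
proof -
  obtain e :: "nat \<Rightarrow> real" where e: "range e \<subseteq> I"
    and sup: "maximal_payoff = (\<lambda>lam z. SUP k. ereal (e k * z - lam * F (e k)))"
    by (rule maximal_payoff_countable)
  define pay where "pay y \<omega> = y * (X \<omega> - \<mu>) - lam * F y" for y \<omega>
  have pay_meas: "(\<lambda>\<omega>. pay (L \<omega>) \<omega>) \<in> borel_measurable M" if "L \<in> borel_measurable M" for L
    unfolding pay_def using that by simp
  define e' where "e' k = e (fst (prod_decode k))" for k
  \<comment> \<open>The pairing function lists each constant \<open>e i\<close> at infinitely many steps, hence also at steps beyond
    the loss at any given point.\<close>
  define Ls where "Ls = rec_nat L0 (\<lambda>k L \<omega>.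
    if \<omega> \<in> {\<omega> \<in> space M. \<bar>X \<omega>\<bar> \<le> real k \<and> pay (L \<omega>) \<omega> < pay (e' k) \<omega>} then e' k else L \<omega>)"
  have Ls_0: "Ls 0 = L0" by (simp add: Ls_def)
  have Ls_Suc: "Ls (Suc k) = (\<lambda>\<omega>. if \<omega> \<in> {\<omega> \<in> space M. \<bar>X \<omega>\<bar> \<le> real k \<and> pay (Ls k \<omega>) \<omega> < pay (e' k) \<omega>}
      then e' k else Ls k \<omega>)" for k
    unfolding Ls_def by (simp only: nat.rec(2))
  have adm: "Ls k \<in> admissible X" for k
  proof (induction k)
    case 0
    then show ?case using L0 by (simp add: Ls_0)
  next
    case (Suc k)
    have [measurable]: "(\<lambda>\<omega>. pay (Ls k \<omega>) \<omega>) \<in> borel_measurable M" "(\<lambda>\<omega>. pay (e' k) \<omega>) \<in> borel_measurable M"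
      using admissibleD(1)[OF Suc] pay_meas by auto
    show ?case
      unfolding Ls_Suc
    proof (rule admissible_patch[OF X Suc, where b="real k"])
      show "{\<omega> \<in> space M. \<bar>X \<omega>\<bar> \<le> real k \<and> pay (Ls k \<omega>) \<omega> < pay (e' k) \<omega>} \<in> sets M" by measurable
    qed (use e in \<open>auto simp: e'_def\<close>)
  qed
  have pay_int: "integrable M (\<lambda>\<omega>. pay (Ls k \<omega>) \<omega>)" and pay_le: "(\<integral>\<omega>. pay (Ls k \<omega>) \<omega> \<partial>M) \<le> b" for k
    using admissible_payoff_integrable(1)[OF adm] bound[OF adm] by (simp_all add: pay_def)
  have inc: "pay (Ls k \<omega>) \<omega> \<le> pay (Ls (Suc k) \<omega>) \<omega>" for k \<omega>
    by (auto simp: Ls_Suc)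
  have reached: "\<exists>k. pay (e i) \<omega> \<le> pay (Ls k \<omega>) \<omega>" if "\<omega> \<in> space M" for i \<omega>
  proof -
    obtain n :: nat where n: "\<bar>X \<omega>\<bar> \<le> real n" using real_arch_simple by blast
    define k where "k = prod_encode (i, n)"
    have "\<bar>X \<omega>\<bar> \<le> real k"
      using n le_prod_encode_2[of n i] by (simp add: k_def)
    moreover have "e' k = e i" by (simp add: e'_def k_def)
    ultimately have "pay (e i) \<omega> \<le> pay (Ls (Suc k) \<omega>) \<omega>"
      using that by (auto simp: Ls_Suc)
    then show ?thesis ..
  qed
  define V where "V \<omega> = (SUP k. ennreal (pay (Ls k \<omega>) \<omega> - pay (L0 \<omega>) \<omega>))" for \<omega>
  have meas_Ls [measurable]: "(\<lambda>\<omega>. pay (Ls k \<omega>) \<omega>) \<in> borel_measurable M" for k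
    by (rule pay_meas[OF admissibleD(1)[OF adm]])
  have meas_L0 [measurable]: "(\<lambda>\<omega>. pay (L0 \<omega>) \<omega>) \<in> borel_measurable M"
    by (rule pay_meas[OF admissibleD(1)[OF L0]])
  have V_meas [measurable]: "V \<in> borel_measurable M"
    unfolding V_def by simp
  have ge_L0: "pay (L0 \<omega>) \<omega> \<le> pay (Ls k \<omega>) \<omega>" for k \<omega>
    by (induction k) (auto simp: Ls_0 intro: order_trans[OF _ inc])
  define B where "B = b - (\<integral>\<omega>. pay (L0 \<omega>) \<omega> \<partial>M)"
  have "(\<integral>\<^sup>+ \<omega>. V \<omega> \<partial>M) = (SUP k. \<integral>\<^sup>+ \<omega>. ennreal (pay (Ls k \<omega>) \<omega> - pay (L0 \<omega>) \<omega>) \<partial>M)"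
    unfolding V_def
    by (rule nn_integral_monotone_convergence_SUP)
       (auto intro!: incseq_SucI le_funI ennreal_leI diff_right_mono inc)
  also have "\<dots> \<le> ennreal B"
  proof (rule SUP_least)
    fix k
    have "(\<integral>\<^sup>+ \<omega>. ennreal (pay (Ls k \<omega>) \<omega> - pay (L0 \<omega>) \<omega>) \<partial>M)
        = ennreal (\<integral>\<omega>. pay (Ls k \<omega>) \<omega> - pay (L0 \<omega>) \<omega> \<partial>M)"
      using pay_int[of k] pay_int[of 0] ge_L0 by (intro nn_integral_eq_integral) (auto simp: Ls_0)
    also have "\<dots> \<le> ennreal B"
      using pay_int[of k] pay_int[of 0] pay_le[of k] by (intro ennreal_leI) (simp add: Ls_0 B_def)
    finally show "(\<integral>\<^sup>+ \<omega>. ennreal (pay (Ls k \<omega>) \<omega> - pay (L0 \<omega>) \<omega>) \<partial>M) \<le> ennreal B" .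
  qed
  finally have V_le: "(\<integral>\<^sup>+ \<omega>. V \<omega> \<partial>M) \<le> ennreal B" .
  have B0: "0 \<le> B"
    using pay_le[of 0] by (simp add: B_def Ls_0)
  have V_fin: "AE \<omega> in M. V \<omega> \<noteq> \<infinity>"
    using V_le by (intro nn_integral_PInf_AE) (auto simp: top_unique)
  have eqV: "(\<integral>\<^sup>+ \<omega>. ennreal (enn2real (V \<omega>)) \<partial>M) = (\<integral>\<^sup>+ \<omega>. V \<omega> \<partial>M)"
    using V_fin by (intro nn_integral_cong_AE) (auto elim!: eventually_mono simp: less_top)
  have V_int: "integrable M (\<lambda>\<omega>. enn2real (V \<omega>))"
    using V_le eqV by (intro integrableI_nonneg) (auto intro: le_less_trans)
  have V_bound: "(\<integral>\<omega>. enn2real (V \<omega>) \<partial>M) \<le> B"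
    using V_le eqV B0 by (simp add: integral_eq_nn_integral enn2real_leI)
  have "ext_integral M (\<lambda>\<omega>. maximal_payoff lam (X \<omega> - \<mu>))
      \<le> ext_integral M (\<lambda>\<omega>. ereal (pay (L0 \<omega>) \<omega> + enn2real (V \<omega>)))"
  proof (rule ext_integral_mono_AE)
    show "AE \<omega> in M. maximal_payoff lam (X \<omega> - \<mu>) \<le> ereal (pay (L0 \<omega>) \<omega> + enn2real (V \<omega>))"
      using V_fin AE_space
    proof eventually_elim
      case (elim \<omega>)
      have "ereal (e i * (X \<omega> - \<mu>) - lam * F (e i)) \<le> ereal (pay (L0 \<omega>) \<omega> + enn2real (V \<omega>))" for i
      proof -
        obtain k where k: "pay (e i) \<omega> \<le> pay (Ls k \<omega>) \<omega>" using reached[OF elim(2)] by blast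
        have "ennreal (pay (Ls k \<omega>) \<omega> - pay (L0 \<omega>) \<omega>) \<le> V \<omega>"
          unfolding V_def by (rule SUP_upper) simp
        then have "pay (Ls k \<omega>) \<omega> - pay (L0 \<omega>) \<omega> \<le> enn2real (V \<omega>)"
          using elim(1) ge_L0[of \<omega> k] by (cases "V \<omega>") auto
        with k show ?thesis by (simp add: pay_def)
      qed
      then show ?case unfolding sup by (intro SUP_least)
    qed
  qed
  also have "\<dots> = ereal ((\<integral>\<omega>. pay (L0 \<omega>) \<omega> \<partial>M) + (\<integral>\<omega>. enn2real (V \<omega>) \<partial>M))"
    using pay_int[of 0] V_int by (subst ext_integral_real) (auto simp: Ls_0)
  also have "\<dots> \<le> ereal b"
    using V_bound by (simp add: B_def)
  finally show ?thesis .
qed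

text \<open>Slater's condition: constants near \<open>1\<close> have divergence below \<open>\<rho>\<close> and mass on both sides of \<open>1\<close>.
  They need not be admissible themselves, but become so when replaced by an admissible likelihood where
  the loss is large.\<close>

lemma slater_point:
  assumes X[measurable]: "X \<in> borel_measurable M" and L0: "L0 \<in> admissible X"
    and y: "y \<in> I" "F y < F 1 + \<rho>" and e: "0 < e"
  obtains L where "L \<in> admissible X" "(\<integral>\<omega>. F (L \<omega>) \<partial>M) < F 1 + \<rho>" "\<bar>(\<integral>\<omega>. L \<omega> \<partial>M) - y\<bar> < e"
proof -
  define B where "B n = {\<omega> \<in> space M. \<bar>X \<omega>\<bar> \<le> real n}" for n :: nat
  define L where "L n \<omega> = (if \<omega> \<in> B n then y else L0 \<omega>)" for n \<omega>
  note [measurable] = admissibleD(1)[OF L0]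
  have [measurable]: "B n \<in> sets M" for n unfolding B_def by simp
  have adm: "L n \<in> admissible X" for n
    unfolding L_def by (rule admissible_patch[OF X L0 y(1), where b="real n"]) (auto simp: B_def)
  have ev: "eventually (\<lambda>n. L n \<omega> = y) sequentially" if "\<omega> \<in> space M" for \<omega>
  proof -
    obtain n0 :: nat where "\<bar>X \<omega>\<bar> \<le> real n0" using real_arch_simple by blast
    then have "L n \<omega> = y" if "n0 \<le> n" for n
      using that \<open>\<omega> \<in> space M\<close> by (simp add: L_def B_def)
    then show ?thesis by (auto simp: eventually_sequentially)
  qed
  have "(\<lambda>n. \<integral>\<omega>. L n \<omega> \<partial>M) \<longlonglongrightarrow> (\<integral>\<omega>. y \<partial>M)"
  proof (rule integral_dominated_convergence[where w="\<lambda>\<omega>. \<bar>y\<bar> + \<bar>L0 \<omega>\<bar>"])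
    show "AE \<omega> in M. (\<lambda>n. L n \<omega>) \<longlonglongrightarrow> y"
      using ev by (intro AE_I2 tendsto_eventually)
    show "L n \<in> borel_measurable M" for n by (rule admissibleD(1)[OF adm])
  qed (use admissibleD(3)[OF L0] in \<open>auto simp: L_def\<close>)
  then have "(\<lambda>n. \<integral>\<omega>. L n \<omega> \<partial>M) \<longlonglongrightarrow> y" by (simp add: prob_space)
  from LIMSEQ_D[OF this e] obtain N1 where N1: "\<And>n. N1 \<le> n \<Longrightarrow> \<bar>(\<integral>\<omega>. L n \<omega> \<partial>M) - y\<bar> < e"
    by (auto simp: dist_real_def)
  have "(\<lambda>n. \<integral>\<omega>. F (L n \<omega>) \<partial>M) \<longlonglongrightarrow> (\<integral>\<omega>. F y \<partial>M)"
  proof (rule integral_dominated_convergence[where w="\<lambda>\<omega>. \<bar>F y\<bar> + \<bar>F (L0 \<omega>)\<bar>"])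
    show "AE \<omega> in M. (\<lambda>n. F (L n \<omega>)) \<longlonglongrightarrow> F y"
      using ev by (intro AE_I2 tendsto_eventually) (metis (mono_tags, lifting) eventually_mono)
    show "(\<lambda>\<omega>. F (L n \<omega>)) \<in> borel_measurable M" for n
      using admissibleD(1)[OF adm] by simp
  qed (use admissibleD(4)[OF L0] in \<open>auto simp: L_def\<close>)
  then have "(\<lambda>n. \<integral>\<omega>. F (L n \<omega>) \<partial>M) \<longlonglongrightarrow> F y" by (simp add: prob_space)
  from order_tendstoD(2)[OF this y(2)] obtain N2
    where N2: "\<And>n. N2 \<le> n \<Longrightarrow> (\<integral>\<omega>. F (L n \<omega>) \<partial>M) < F 1 + \<rho>"
    by (auto simp: eventually_sequentially)
  show thesis
    by (rule that[OF adm[of "max N1 N2"] N2 N1]) auto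
qed

lemma points_near_one:
  obtains \<delta> where "0 < \<delta>" "1 + \<delta> \<in> I" "1 - \<delta> \<in> I" "F (1 + \<delta>) < F 1 + \<rho>" "F (1 - \<delta>) < F 1 + \<rho>"
proof -
  have "continuous_on (interior I) F"
    by (intro convex_on_continuous convex_on_subset[OF F_convex interior_subset] convex_interior I_convex) simp
  then have "isCont F 1" using one_interior by (simp add: continuous_on_eq_continuous_at)
  then have "F \<midarrow>1\<rightarrow> F 1" by (simp add: isCont_def)
  from LIM_D[OF this rho_pos] obtain s where s: "0 < s"
    and close: "\<And>x. x \<noteq> 1 \<Longrightarrow> \<bar>x - 1\<bar> < s \<Longrightarrow> \<bar>F x - F 1\<bar> < \<rho>" by auto
  obtain r where r: "0 < r" "cball 1 r \<subseteq> I"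
    using one_interior by (meson mem_interior_cball)
  define \<delta> where "\<delta> = min r (s / 2)"
  have \<delta>: "0 < \<delta>" "\<delta> \<le> r" "\<delta> < s" using r s by (auto simp: \<delta>_def)
  show thesis
  proof (rule that[OF \<delta>(1)])
    show "1 + \<delta> \<in> I" "1 - \<delta> \<in> I" using r(2) \<delta> by (auto simp: subset_iff dist_real_def)
    show "F (1 + \<delta>) < F 1 + \<rho>" "F (1 - \<delta>) < F 1 + \<rho>"
      using close[of "1 + \<delta>"] close[of "1 - \<delta>"] \<delta> by auto
  qed
qed

text \<open>The multipliers come from a hyperplane in \<open>\<real>\<^sup>3\<close> separating \<open>0\<close> from the attainable
  triples (excess divergence, excess mass, shortfall of the expected loss below \<open>w\<close>). It is not
  vertical by Slater's condition.\<close>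

lemma lagrange_multipliers:
  assumes X: "X \<in> borel_measurable M" and L0: "L0 \<in> admissible X"
    and bound: "\<And>L. L \<in> admissible X \<Longrightarrow> (\<integral>\<omega>. L \<omega> \<partial>M) = 1 \<Longrightarrow> (\<integral>\<omega>. F (L \<omega>) \<partial>M) \<le> F 1 + \<rho>
      \<Longrightarrow> (\<integral>\<omega>. L \<omega> * X \<omega> \<partial>M) \<le> w"
  obtains lam \<mu> where "0 \<le> lam" "\<And>L. L \<in> admissible X \<Longrightarrow>
    (\<integral>\<omega>. L \<omega> * (X \<omega> - \<mu>) - lam * F (L \<omega>) \<partial>M) \<le> w - lam * (\<rho> + F 1) - \<mu>"
proof -
  define p where "p L = (\<integral>\<omega>. F (L \<omega>) \<partial>M) - F 1 - \<rho>" for L :: "'w \<Rightarrow> real"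
  define s where "s L = (\<integral>\<omega>. L \<omega> \<partial>M) - 1" for L :: "'w \<Rightarrow> real"
  define r where "r L = w - (\<integral>\<omega>. L \<omega> * X \<omega> \<partial>M)" for L
  \<comment> \<open>Inequalities in the first and third coordinate make \<open>C\<close> convex and force \<open>\<alpha>\<close> and \<open>\<gamma>\<close> to be nonnegative;
    strictness in the third keeps \<open>0\<close> outside.\<close>
  define C where "C = {(x :: real, y :: real, z :: real). \<exists>L\<in>admissible X. p L \<le> x \<and> s L = y \<and> r L < z}"
  have "convex C"
  proof (rule convexI)
    fix P Q :: "real \<times> real \<times> real" and a b :: real
    assume PQ: "P \<in> C" "Q \<in> C" and ab: "0 \<le> a" "0 \<le> b" "a + b = 1"
    obtain x y z x' y' z' where PQ_eq: "P = (x, y, z)" "Q = (x', y', z')"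
      by (cases P; cases Q) auto
    obtain L where L: "L \<in> admissible X" "p L \<le> x" "s L = y" "r L < z"
      using PQ(1) PQ_eq(1) by (auto simp: C_def)
    obtain L' where L': "L' \<in> admissible X" "p L' \<le> x'" "s L' = y'" "r L' < z'"
      using PQ(2) PQ_eq(2) by (auto simp: C_def)
    define N where "N \<omega> = a * L \<omega> + b * L' \<omega>" for \<omega>
    have N: "N \<in> admissible X" "(\<integral>\<omega>. F (N \<omega>) \<partial>M) \<le> a * (\<integral>\<omega>. F (L \<omega>) \<partial>M) + b * (\<integral>\<omega>. F (L' \<omega>) \<partial>M)"
      unfolding N_def using admissible_convex[OF L(1) L'(1) ab] by auto
    have b: "b = 1 - a" using ab(3) by simp
    note int = admissibleD(3,5)[OF L(1)] admissibleD(3,5)[OF L'(1)]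
    have "(\<integral>\<omega>. N \<omega> \<partial>M) = a * (\<integral>\<omega>. L \<omega> \<partial>M) + b * (\<integral>\<omega>. L' \<omega> \<partial>M)"
      unfolding N_def using int by simp
    then have sN: "s N = a * y + b * y'"
      unfolding L(3)[symmetric] L'(3)[symmetric] s_def b by (simp add: algebra_simps)
    have "(\<integral>\<omega>. N \<omega> * X \<omega> \<partial>M) = a * (\<integral>\<omega>. L \<omega> * X \<omega> \<partial>M) + b * (\<integral>\<omega>. L' \<omega> * X \<omega> \<partial>M)"
      unfolding N_def using int by (simp add: distrib_right mult.assoc)
    then have rN: "r N = a * r L + b * r L'"
      unfolding r_def b by (simp add: algebra_simps)
    also have "\<dots> < a * z + b * z'"
    proof (cases "a = 0")
      case True
      with ab L'(4) show ?thesis by simp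
    next
      case False
      with ab have "a * r L < a * z" using L(4) by simp
      moreover have "b * r L' \<le> b * z'" using ab L'(4) by (intro mult_left_mono) auto
      ultimately show ?thesis by linarith
    qed
    finally have "r N < a * z + b * z'" .
    moreover have "p N \<le> a * x + b * x'"
    proof -
      have "p N \<le> a * p L + b * p L'"
        using N(2) unfolding p_def b by (simp add: algebra_simps)
      also have "\<dots> \<le> a * x + b * x'"
        using ab L(2) L'(2) by (intro add_mono mult_left_mono) auto
      finally show ?thesis .
    qed
    ultimately show "a *\<^sub>R P + b *\<^sub>R Q \<in> C"
      using N(1) sN by (auto simp: C_def PQ_eq)
  qed
  moreover have "0 \<notin> C"
    using bound by (force simp: C_def zero_prod_def p_def s_def r_def)
  ultimately obtain n where n: "n \<noteq> 0" "\<forall>x\<in>C. 0 \<le> inner n x"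
    using separating_hyperplane_set_0 by blast
  obtain \<alpha> \<beta> \<gamma> where n_eq: "n = (\<alpha>, \<beta>, \<gamma>)" by (cases n) auto
  have sep: "0 \<le> \<alpha> * x + \<beta> * s L + \<gamma> * z" if "L \<in> admissible X" "p L \<le> x" "r L < z" for L x z
  proof -
    have "(x, s L, z) \<in> C" using that by (auto simp: C_def)
    with n(2) show ?thesis by (auto simp: n_eq)
  qed
  have \<alpha>: "0 \<le> \<alpha>"
  proof (rule ccontr)
    assume "\<not> 0 \<le> \<alpha>"
    define q where "q = \<beta> * s L0 + \<gamma> * (r L0 + 1)"
    have "0 \<le> \<alpha> * x + q" if "p L0 \<le> x" for x
      using sep[OF L0 that, of "r L0 + 1"] by (simp add: q_def)
    from this[of "max (p L0) ((\<bar>q\<bar> + 1) / - \<alpha>)"]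
    have "\<alpha> * ((\<bar>q\<bar> + 1) / - \<alpha>) + q \<ge> 0"
      using \<open>\<not> 0 \<le> \<alpha>\<close> mult_left_mono_neg[of "(\<bar>q\<bar> + 1) / - \<alpha>" "max (p L0) ((\<bar>q\<bar> + 1) / - \<alpha>)" \<alpha>] by auto
    moreover have "\<alpha> * ((\<bar>q\<bar> + 1) / - \<alpha>) = - (\<bar>q\<bar> + 1)" using \<open>\<not> 0 \<le> \<alpha>\<close> by simp
    ultimately show False by linarith
  qed
  have \<gamma>: "0 \<le> \<gamma>"
  proof (rule ccontr)
    assume "\<not> 0 \<le> \<gamma>"
    define q where "q = \<alpha> * p L0 + \<beta> * s L0"
    have "0 \<le> \<gamma> * z + q" if "r L0 < z" for z
      using sep[OF L0 order_refl that] by (simp add: q_def)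
    have "r L0 < max (r L0 + 1) ((\<bar>q\<bar> + 1) / - \<gamma>)" by linarith
    from \<open>\<And>z. r L0 < z \<Longrightarrow> 0 \<le> \<gamma> * z + q\<close>[OF this]
    have "\<gamma> * ((\<bar>q\<bar> + 1) / - \<gamma>) + q \<ge> 0"
      using \<open>\<not> 0 \<le> \<gamma>\<close> mult_left_mono_neg[of "(\<bar>q\<bar> + 1) / - \<gamma>" "max (r L0 + 1) ((\<bar>q\<bar> + 1) / - \<gamma>)" \<gamma>] by auto
    moreover have "\<gamma> * ((\<bar>q\<bar> + 1) / - \<gamma>) = - (\<bar>q\<bar> + 1)" using \<open>\<not> 0 \<le> \<gamma>\<close> by simp
    ultimately show False by linarith
  qed
  \<comment> \<open>The separation holds on the boundary of \<open>C\<close> too, that is for \<open>z = r L\<close>.\<close>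
  have sep': "0 \<le> \<alpha> * p L + \<beta> * s L + \<gamma> * r L" if L: "L \<in> admissible X" for L
  proof (rule field_le_epsilon)
    fix e :: real assume e: "0 < e"
    have "0 \<le> \<alpha> * p L + \<beta> * s L + \<gamma> * (r L + e / (\<gamma> + 1))"
      using e \<gamma> by (intro sep[OF L]) auto
    moreover have "\<gamma> * (e / (\<gamma> + 1)) \<le> e" using e \<gamma> by (simp add: field_simps)
    ultimately show "0 \<le> \<alpha> * p L + \<beta> * s L + \<gamma> * r L + e" by (simp add: distrib_left)
  qed
  \<comment> \<open>Two strictly feasible divergences with excess mass of either sign leave only the zero normal.\<close>
  have "\<gamma> \<noteq> 0"
  proof
    assume \<gamma>0: "\<gamma> = 0"
    obtain \<delta> where \<delta>: "0 < \<delta>" "1 + \<delta> \<in> I" "1 - \<delta> \<in> I" "F (1 + \<delta>) < F 1 + \<rho>" "F (1 - \<delta>) < F 1 + \<rho>"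
      by (rule points_near_one)
    obtain L1 where L1: "L1 \<in> admissible X" "(\<integral>\<omega>. F (L1 \<omega>) \<partial>M) < F 1 + \<rho>" "\<bar>(\<integral>\<omega>. L1 \<omega> \<partial>M) - (1 + \<delta>)\<bar> < \<delta>"
      by (rule slater_point[OF X L0 \<delta>(2,4,1)])
    obtain L2 where L2: "L2 \<in> admissible X" "(\<integral>\<omega>. F (L2 \<omega>) \<partial>M) < F 1 + \<rho>" "\<bar>(\<integral>\<omega>. L2 \<omega> \<partial>M) - (1 - \<delta>)\<bar> < \<delta>"
      by (rule slater_point[OF X L0 \<delta>(3,5,1)])
    have p: "p L1 < 0" "p L2 < 0" and s: "0 < s L1" "s L2 < 0"
      using L1 L2 by (auto simp: p_def s_def)
    have 1: "0 \<le> \<alpha> * p L1 + \<beta> * s L1" and 2: "0 \<le> \<alpha> * p L2 + \<beta> * s L2"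
      using sep'[OF L1(1)] sep'[OF L2(1)] \<gamma>0 by simp_all
    have \<alpha>p: "\<alpha> * p L1 \<le> 0" "\<alpha> * p L2 \<le> 0" using \<alpha> p by (auto intro: mult_nonneg_nonpos)
    have "0 \<le> \<beta> * s L1" "0 \<le> \<beta> * s L2" using 1 2 \<alpha>p by linarith+
    then have "\<beta> = 0" using s by (auto simp: zero_le_mult_iff)
    with 1 p \<alpha> have "\<alpha> = 0" by (auto simp: zero_le_mult_iff)
    with \<open>\<beta> = 0\<close> \<gamma>0 n(1) show False by (simp add: n_eq zero_prod_def)
  qed
  with \<gamma> have \<gamma>_pos: "0 < \<gamma>" by simp
  show thesis
  proof (rule that[of "\<alpha> / \<gamma>" "\<beta> / \<gamma>"])
    show "0 \<le> \<alpha> / \<gamma>" using \<alpha> \<gamma> by simp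
    fix L assume L: "L \<in> admissible X"
    have "0 \<le> (\<alpha> * p L + \<beta> * s L + \<gamma> * r L) / \<gamma>" using sep'[OF L] \<gamma>_pos by simp
    also have "\<dots> = \<alpha> / \<gamma> * p L + \<beta> / \<gamma> * s L + r L" using \<gamma>_pos by (simp add: field_simps)
    finally show "(\<integral>\<omega>. L \<omega> * (X \<omega> - \<beta> / \<gamma>) - \<alpha> / \<gamma> * F (L \<omega>) \<partial>M) \<le> w - \<alpha> / \<gamma> * (\<rho> + F 1) - \<beta> / \<gamma>"
      unfolding admissible_payoff_integrable(2)[OF L] p_def s_def r_def
      by (simp add: algebra_simps)
  qed
qed

text \<open>The Lagrangian bound of the previous lemma holds for each admissible likelihood separately; taking the
  supremum inside the integral turns it into a bound on the dual loss.\<close>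

lemma dual_loss_le_of_primal_bound:
  assumes X: "X \<in> borel_measurable M" and L0: "L0 \<in> admissible X"
    and bound: "\<And>L. L \<in> admissible X \<Longrightarrow> (\<integral>\<omega>. L \<omega> \<partial>M) = 1 \<Longrightarrow> (\<integral>\<omega>. F (L \<omega>) \<partial>M) \<le> F 1 + \<rho>
      \<Longrightarrow> (\<integral>\<omega>. L \<omega> * X \<omega> \<partial>M) \<le> w"
  obtains lam \<mu> where "0 \<le> lam" "dual_loss f \<rho> M (\<lambda>\<omega>. ereal (X \<omega>)) lam \<mu> \<le> ereal w"
proof -
  obtain lam \<mu> where lam: "0 \<le> lam" and le: "\<And>L. L \<in> admissible X \<Longrightarrow>
      (\<integral>\<omega>. L \<omega> * (X \<omega> - \<mu>) - lam * F (L \<omega>) \<partial>M) \<le> w - lam * (\<rho> + F 1) - \<mu>"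
    using lagrange_multipliers[OF X L0 bound] by blast
  have "ext_integral M (\<lambda>\<omega>. maximal_payoff lam (X \<omega> - \<mu>)) \<le> ereal (w - lam * (\<rho> + F 1) - \<mu>)"
    by (rule integral_maximal_payoff_le[OF X L0 le])
  then have "dual_loss f \<rho> M (\<lambda>\<omega>. ereal (X \<omega>)) lam \<mu>
      \<le> ereal (lam * (\<rho> + F 1) + \<mu>) + ereal (w - lam * (\<rho> + F 1) - \<mu>)"
    unfolding dual_loss_real[OF lam one_in_I] by (rule add_left_mono)
  with lam show thesis by (intro that) simp_all
qed

end

section \<open>Strong duality without integrability of the loss\<close>

context interior_divergence_model
begin

text \<open>Raising \<open>lam\<close> by \<open>1\<close> and \<open>\<mu>\<close> by \<open>1 - c\<close> lowers the payoff, up to a constant, by the mass plus the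
  nonnegative gap between \<open>f\<close> and its tangent at \<open>1\<close>. In particular the dual loss is finite at both pairs of
  multipliers. For a likelihood that is almost optimal at the second pair, mass plus gap is bounded by the
  difference of the two maximal payoffs, so each of the two is integrable.\<close>

lemma admissible_nonempty:
  assumes X[measurable]: "X \<in> borel_measurable M" and lam: "0 \<le> lam"
    and upper: "dual_loss f \<rho> M (\<lambda>\<omega>. ereal (X \<omega>)) lam \<mu> \<noteq> \<infinity>"
    and lower: "dual_loss f \<rho> M (\<lambda>\<omega>. ereal (X \<omega>)) (lam + 1) (\<mu> + 1 - c) \<noteq> -\<infinity>"
  shows "admissible X \<noteq> {}"
proof -
  define P where "P \<omega> = maximal_payoff lam (X \<omega> - \<mu>)" for \<omega>
  define P' where "P' \<omega> = maximal_payoff (lam + 1) (X \<omega> - (\<mu> + 1 - c))" for \<omega>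
  have [measurable]: "P \<in> borel_measurable M" "P' \<in> borel_measurable M"
    unfolding P_def P'_def by simp_all
  define pay where "pay y \<omega> = y * (X \<omega> - (\<mu> + 1 - c)) - (lam + 1) * F y" for y \<omega>
  define gap where "gap y = F y - (F 1 + c * (y - 1))" for y
  have gap: "0 \<le> gap y" if "y \<in> I" for y
    using subgradient[OF that] by (simp add: gap_def)
  have pay_diff: "y * (X \<omega> - \<mu>) - lam * F y = pay y \<omega> + (y + gap y) + (F 1 - c)" for y \<omega>
    by (simp add: pay_def gap_def algebra_simps)
  have pay_P: "ereal (pay y \<omega> + (y + gap y) + (F 1 - c)) \<le> P \<omega>" if "y \<in> I" for y \<omega>
    unfolding pay_diff[symmetric] P_def using that by (rule maximal_payoff_upper)
  have pay_P': "ereal (pay y \<omega>) \<le> P' \<omega>" if "y \<in> I" for y \<omega>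
    unfolding pay_def P'_def using that by (rule maximal_payoff_upper)
  have P'_P: "P' \<omega> + ereal (F 1 - c) \<le> P \<omega>" for \<omega>
  proof -
    have "P' \<omega> \<le> P \<omega> - ereal (F 1 - c)"
      unfolding P'_def
    proof (rule maximal_payoff_least)
      fix y assume y: "y \<in> I"
      have "ereal (pay y \<omega> + (F 1 - c)) \<le> ereal (pay y \<omega> + (y + gap y) + (F 1 - c))"
        using I_nonneg[OF y] gap[OF y] by simp
      also have "\<dots> \<le> P \<omega>" by (rule pay_P[OF y])
      finally show "ereal (y * (X \<omega> - (\<mu> + 1 - c)) - (lam + 1) * F y) \<le> P \<omega> - ereal (F 1 - c)"
        unfolding pay_def[symmetric] by (cases "P \<omega>") auto
    qed
    then show ?thesis by (cases "P \<omega>"; cases "P' \<omega>") auto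
  qed
  have "ext_integral M P \<noteq> \<infinity>"
    using upper unfolding dual_loss_real[OF lam one_in_I] P_def[symmetric] by auto
  then have P_pos: "(\<integral>\<^sup>+ \<omega>. e2ennreal (P \<omega>) \<partial>M) \<noteq> \<infinity>"
    using ext_integral_eq_infinity by blast
  have "0 \<le> lam + 1" using lam by simp
  from lower[unfolded dual_loss_real[OF this one_in_I], folded P'_def]
  have P'_MInf: "ext_integral M P' \<noteq> -\<infinity>" by auto
  define k where "k = \<bar>F 1 - c\<bar>"
  have shift: "e2ennreal x \<le> e2ennreal y + ennreal k" if "x + ereal (F 1 - c) \<le> y" for x y
  proof (cases x; cases y)
    fix x' y' assume xy: "x = ereal x'" "y = ereal y'"
    have "ennreal x' \<le> ennreal (max 0 y' + k)"
      using that unfolding xy k_def by (intro ennreal_leI) (auto simp: abs_if split: if_splits)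
    also have "\<dots> = ennreal y' + ennreal k"
      by (simp add: ennreal_plus k_def max_def ennreal_neg)
    finally show ?thesis by (simp add: xy)
  qed (use that in \<open>auto simp: e2ennreal_neg\<close>)
  have "(\<integral>\<^sup>+ \<omega>. e2ennreal (P' \<omega>) \<partial>M) \<le> (\<integral>\<^sup>+ \<omega>. e2ennreal (P \<omega>) + ennreal k \<partial>M)"
    using shift[OF P'_P] by (intro nn_integral_mono) auto
  also have "\<dots> = (\<integral>\<^sup>+ \<omega>. e2ennreal (P \<omega>) \<partial>M) + ennreal k"
    by (simp add: nn_integral_add emeasure_space_1)
  also have "\<dots> < \<infinity>" using P_pos by (simp add: less_top)
  finally have P'_pos: "(\<integral>\<^sup>+ \<omega>. e2ennreal (P' \<omega>) \<partial>M) \<noteq> \<infinity>" by simp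
  have P'_neg: "(\<integral>\<^sup>+ \<omega>. e2ennreal (- P' \<omega>) \<partial>M) \<noteq> \<infinity>"
    using P'_MInf P'_pos unfolding ext_integral_def
    by (cases "\<integral>\<^sup>+ \<omega>. e2ennreal (P' \<omega>) \<partial>M") auto
  have "(\<integral>\<^sup>+ \<omega>. e2ennreal (- P \<omega>) \<partial>M) \<le> (\<integral>\<^sup>+ \<omega>. e2ennreal (- P' \<omega>) + ennreal k \<partial>M)"
  proof (intro nn_integral_mono shift)
    fix \<omega>
    show "- P \<omega> + ereal (F 1 - c) \<le> - P' \<omega>"
      using P'_P[of \<omega>] by (cases "P \<omega>"; cases "P' \<omega>") auto
  qed
  also have "\<dots> = (\<integral>\<^sup>+ \<omega>. e2ennreal (- P' \<omega>) \<partial>M) + ennreal k"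
    by (simp add: nn_integral_add emeasure_space_1)
  also have "\<dots> < \<infinity>" using P'_neg by (simp add: less_top)
  finally have P_neg: "(\<integral>\<^sup>+ \<omega>. e2ennreal (- P \<omega>) \<partial>M) \<noteq> \<infinity>" by simp
  define g where "g \<omega> = real_of_ereal (P \<omega>)" for \<omega>
  define g' where "g' \<omega> = real_of_ereal (P' \<omega>)" for \<omega>
  have P: "AE \<omega> in M. \<bar>P \<omega>\<bar> \<noteq> \<infinity>" "integrable M g"
    using ext_integral_finite(1,2)[of P M] P_pos P_neg by (simp_all add: ext_integral_finite_iff_parts g_def[abs_def])
  have P': "AE \<omega> in M. \<bar>P' \<omega>\<bar> \<noteq> \<infinity>" "integrable M g'"
    using ext_integral_finite(1,2)[of P' M] P'_pos P'_neg by (simp_all add: ext_integral_finite_iff_parts g'_def[abs_def])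
  obtain e :: "nat \<Rightarrow> real" where e: "range e \<subseteq> I"
    and sup: "maximal_payoff = (\<lambda>lam z. SUP k. ereal (e k * z - lam * F (e k)))"
    by (rule maximal_payoff_countable)
  \<comment> \<open>A measurable choice of a likelihood whose payoff is within \<open>1\<close> of the maximum.\<close>
  define N where "N \<omega> = (LEAST k. g' \<omega> - 1 \<le> pay (e k) \<omega>)" for \<omega>
  define L where "L \<omega> = e (N \<omega>)" for \<omega>
  have pay_meas: "(\<lambda>\<omega>. pay y \<omega>) \<in> borel_measurable M" for y
    unfolding pay_def by simp
  have N: "N \<in> measurable M (count_space UNIV)"
    unfolding N_def
  proof (rule measurable_Least)
    fix k
    show "Measurable.pred M (\<lambda>\<omega>. g' \<omega> - 1 \<le> pay (e k) \<omega>)"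
      unfolding pred_def using P'(2) pay_meas by (intro borel_measurable_le) auto
  qed
  then have L[measurable]: "L \<in> borel_measurable M"
    unfolding L_def by (rule measurable_compose) simp
  have LI: "L \<omega> \<in> I" for \<omega> using e by (auto simp: L_def)
  have near: "AE \<omega> in M. g' \<omega> - 1 \<le> pay (L \<omega>) \<omega>"
    using P'(1)
  proof eventually_elim
    case (elim \<omega>)
    have "ereal (g' \<omega> - 1) < P' \<omega>"
      unfolding g'_def using elim by (cases "P' \<omega>") auto
    then obtain k where "ereal (g' \<omega> - 1) < ereal (pay (e k) \<omega>)"
      unfolding P'_def sup pay_def less_SUP_iff by auto
    then have "g' \<omega> - 1 \<le> pay (e k) \<omega>" by simp
    then show ?case unfolding L_def N_def by (rule LeastI)
  qed
  have bounds: "AE \<omega> in M. pay (L \<omega>) \<omega> \<le> g' \<omega> \<and> g' \<omega> - 1 \<le> pay (L \<omega>) \<omega>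
      \<and> L \<omega> + gap (L \<omega>) \<le> g \<omega> - g' \<omega> + 1 - (F 1 - c)"
    using near P(1) P'(1)
  proof eventually_elim
    case (elim \<omega>)
    have "pay (L \<omega>) \<omega> + (L \<omega> + gap (L \<omega>)) + (F 1 - c) \<le> g \<omega>"
      using pay_P[OF LI, of \<omega> \<omega>] elim(2) unfolding g_def by (cases "P \<omega>") auto
    moreover have "pay (L \<omega>) \<omega> \<le> g' \<omega>"
      using pay_P'[OF LI, of \<omega> \<omega>] elim(3) unfolding g'_def by (cases "P' \<omega>") auto
    ultimately show ?case using elim(1) by simp
  qed
  have L0: "0 \<le> L \<omega>" "0 \<le> gap (L \<omega>)" for \<omega> using I_nonneg[OF LI] gap[OF LI] by auto
  have bd_int: "integrable M (\<lambda>\<omega>. g \<omega> - g' \<omega> + 1 - (F 1 - c))"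
    using P(2) P'(2) by simp
  have L_int: "integrable M L"
  proof (rule Bochner_Integration.integrable_bound[OF bd_int L])
    show "AE \<omega> in M. norm (L \<omega>) \<le> norm (g \<omega> - g' \<omega> + 1 - (F 1 - c))"
      using bounds
    proof eventually_elim
      case (elim \<omega>)
      with L0[of \<omega>] show ?case by simp
    qed
  qed
  have gap_int: "integrable M (\<lambda>\<omega>. gap (L \<omega>))"
  proof (rule Bochner_Integration.integrable_bound[OF bd_int])
    show "(\<lambda>\<omega>. gap (L \<omega>)) \<in> borel_measurable M" unfolding gap_def by simp
    show "AE \<omega> in M. norm (gap (L \<omega>)) \<le> norm (g \<omega> - g' \<omega> + 1 - (F 1 - c))"
      using bounds
    proof eventually_elim
      case (elim \<omega>)
      with L0[of \<omega>] show ?case by simp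
    qed
  qed
  have "integrable M (\<lambda>\<omega>. gap (L \<omega>) + (F 1 + c * (L \<omega> - 1)))"
    using L_int gap_int by simp
  then have F_int: "integrable M (\<lambda>\<omega>. F (L \<omega>))" by (simp add: gap_def)
  have "integrable M (\<lambda>\<omega>. pay (L \<omega>) \<omega>)"
  proof (rule Bochner_Integration.integrable_bound)
    show "integrable M (\<lambda>\<omega>. \<bar>g' \<omega>\<bar> + 1)" using P'(2) by simp
    show "(\<lambda>\<omega>. pay (L \<omega>) \<omega>) \<in> borel_measurable M" unfolding pay_def by simp
    show "AE \<omega> in M. norm (pay (L \<omega>) \<omega>) \<le> norm (\<bar>g' \<omega>\<bar> + 1)"
      using bounds by eventually_elim auto
  qed
  then have "integrable M (\<lambda>\<omega>. pay (L \<omega>) \<omega> + L \<omega> * (\<mu> + 1 - c) + (lam + 1) * F (L \<omega>))"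
    using L_int F_int by simp
  then have "integrable M (\<lambda>\<omega>. L \<omega> * X \<omega>)" by (simp add: pay_def algebra_simps)
  with L_int F_int L LI have "L \<in> admissible X" by (simp add: admissible_def)
  then show ?thesis by blast
qed

text \<open>If the expectations of \<open>Y \<ge> 0\<close> over the uncertainty set are unbounded, then one of them is infinite:
  take a countable mixture. Mixing in the reference measure with weight one half keeps the likelihood in the
  interior of the domain of \<open>f\<close>, where \<open>f\<close> is continuous, so that the divergence bound survives the limit.\<close>

lemma infinite_expectation_mixture:
  assumes Y[measurable]: "Y \<in> borel_measurable M" and Y0: "\<And>\<omega>. \<omega> \<in> space M \<Longrightarrow> 0 \<le> Y \<omega>"
    and unbounded: "\<And>w :: real. \<exists>L\<in>admissible Y. (\<integral>\<omega>. L \<omega> \<partial>M) = 1 \<and> (\<integral>\<omega>. F (L \<omega>) \<partial>M) \<le> F 1 + \<rho>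
      \<and> w < (\<integral>\<omega>. L \<omega> * Y \<omega> \<partial>M)"
  obtains L where "L \<in> borel_measurable M" "\<And>\<omega>. \<omega> \<in> space M \<Longrightarrow> L \<omega> \<in> I"
    "integrable M L" "(\<integral>\<omega>. L \<omega> \<partial>M) = 1"
    "integrable M (\<lambda>\<omega>. F (L \<omega>))" "(\<integral>\<omega>. F (L \<omega>) \<partial>M) \<le> F 1 + \<rho>"
    "(\<integral>\<^sup>+ \<omega>. ennreal (L \<omega> * Y \<omega>) \<partial>M) = \<infinity>"
proof -
  \<comment> \<open>The \<open>k\<close>-th likelihood will have weight \<open>1 / 2 ^ (k + 2)\<close> in the mixture and so contribute at least \<open>k\<close>.\<close>
  have "\<forall>k. \<exists>L. L \<in> admissible Y \<and> (\<integral>\<omega>. L \<omega> \<partial>M) = 1 \<and> (\<integral>\<omega>. F (L \<omega>) \<partial>M) \<le> F 1 + \<rho>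
      \<and> real k * 2 ^ (k + 2) < (\<integral>\<omega>. L \<omega> * Y \<omega> \<partial>M)"
    using unbounded by blast
  then obtain Lk where Lk: "\<And>k. Lk k \<in> admissible Y" "\<And>k. (\<integral>\<omega>. Lk k \<omega> \<partial>M) = 1"
      "\<And>k. (\<integral>\<omega>. F (Lk k \<omega>) \<partial>M) \<le> F 1 + \<rho>"
      "\<And>k. real k * 2 ^ (k + 2) < (\<integral>\<omega>. Lk k \<omega> * Y \<omega> \<partial>M)"
    by metis
  have [measurable]: "Lk k \<in> borel_measurable M" for k by (rule admissibleD(1)[OF Lk(1)])
  have LkI: "Lk k \<omega> \<in> I" if "\<omega> \<in> space M" for k \<omega> by (rule admissibleD(2)[OF Lk(1) that])
  have Lk0: "0 \<le> Lk k \<omega>" if "\<omega> \<in> space M" for k \<omega> by (rule I_nonneg[OF LkI[OF that]])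
  define wt :: "nat \<Rightarrow> real" where "wt k = (1 / 2) ^ Suc k" for k
  have wt0: "0 < wt k" for k by (simp add: wt_def)
  have wl0: "0 \<le> wt k * Lk k \<omega>" if "\<omega> \<in> space M" for k \<omega>
    using wt0[of k] Lk0[OF that, of k] by simp
  have wt_sum: "(\<Sum>k<n. wt k) + (1 / 2) ^ n = 1" for n
    by (induction n) (auto simp: wt_def)
  have wt_sums: "wt sums 1" unfolding wt_def by (rule power_half_series)
  define gap where "gap y = F y - (F 1 + c * (y - 1))" for y
  have gap0: "0 \<le> gap y" if "y \<in> I" for y
    using subgradient[OF that] by (simp add: gap_def)
  have gap_convex: "convex_on I gap"
  proof -
    have "convex_on I (\<lambda>y. - (F 1 + c * (y - 1)))"
      by (rule convex_onI) (auto simp: algebra_simps I_convex)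
    from convex_on_add[OF F_convex this] show ?thesis by (simp add: gap_def[abs_def] algebra_simps)
  qed
  have gap_int: "integrable M (\<lambda>\<omega>. gap (Lk k \<omega>))" and gap_le: "(\<integral>\<omega>. gap (Lk k \<omega>) \<partial>M) \<le> \<rho>" for k
    unfolding gap_def using admissibleD(3,4)[OF Lk(1), of k] Lk(2,3)[of k] by (simp_all add: prob_space)
  have [measurable]: "gap \<in> borel_measurable borel" unfolding gap_def by simp

  \<comment> \<open>The partial sums are completed to convex combinations \<open>p n\<close> by putting the missing weight on the
    constant \<open>1\<close>, at which the gap vanishes.\<close>
  define S where "S \<omega> = (if summable (\<lambda>k. wt k * Lk k \<omega>) then \<Sum>k. wt k * Lk k \<omega> else 1)" for \<omega>
  define L where "L \<omega> = (1 + S \<omega>) / 2" for \<omega>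
  define p where "p n \<omega> = (\<Sum>k<n. wt k * Lk k \<omega>) + (1 / 2) ^ n" for n \<omega>
  have sums_int: "(\<integral>\<^sup>+ \<omega>. (\<Sum>k. ennreal (wt k * Lk k \<omega>)) \<partial>M) = 1"
  proof -
    have "(\<integral>\<^sup>+ \<omega>. ennreal (wt k * Lk k \<omega>) \<partial>M) = ennreal (wt k)" for k
      using admissibleD(3)[OF Lk(1), of k] Lk(2)[of k] wl0
      by (subst nn_integral_eq_integral) auto
    moreover have "(\<Sum>k. ennreal (wt k)) = 1"
      using wt_sums wt0 by (simp add: suminf_ennreal2 less_imp_le sums_iff)
    ultimately show ?thesis by (subst nn_integral_suminf) simp_all
  qed
  have "AE \<omega> in M. (\<Sum>k. ennreal (wt k * Lk k \<omega>)) \<noteq> \<infinity>"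
    using sums_int by (intro nn_integral_PInf_AE) auto
  then have summ: "AE \<omega> in M. summable (\<lambda>k. wt k * Lk k \<omega>)"
    using AE_space
  proof eventually_elim
    case (elim \<omega>)
    then show ?case
      using wl0 by (intro summable_suminf_not_top) auto
  qed
  have "Measurable.pred M (\<lambda>\<omega>. summable (\<lambda>k. wt k * Lk k \<omega>))"
    unfolding summable_iff_convergent Cauchy_convergent_iff[symmetric] pred_def
    by (rule sets_Collect_Cauchy) simp
  then have [measurable]: "S \<in> borel_measurable M" unfolding S_def by measurable
  then have L_meas[measurable]: "L \<in> borel_measurable M" unfolding L_def by simp
  have p_I: "p n \<omega> \<in> I" and p_gap: "gap (p n \<omega>) \<le> (\<Sum>k<n. wt k * gap (Lk k \<omega>))" if \<omega>: "\<omega> \<in> space M" for n \<omega>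
  proof -
    define y where "y k = (if k < n then Lk k \<omega> else 1)" for k
    define a where "a k = (if k < n then wt k else (1 / 2) ^ n)" for k
    have yI: "y k \<in> I" for k using LkI[OF \<omega>] one_in_I by (simp add: y_def)
    have a0: "0 \<le> a k" for k using wt0 by (simp add: a_def less_imp_le)
    have a1: "(\<Sum>k\<in>{..n}. a k) = 1"
      using wt_sum[of n] by (simp add: a_def lessThan_Suc_atMost[symmetric])
    have eq: "(\<Sum>k\<in>{..n}. a k *\<^sub>R y k) = p n \<omega>"
      by (simp add: a_def y_def p_def lessThan_Suc_atMost[symmetric])
    have "(\<Sum>k\<in>{..n}. a k *\<^sub>R y k) \<in> I"
      by (rule convex_sum[OF _ I_convex a1]) (use a0 yI in auto)
    then show "p n \<omega> \<in> I" by (simp only: eq)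
    have "gap (\<Sum>k\<in>{..n}. a k *\<^sub>R y k) \<le> (\<Sum>k\<in>{..n}. a k * gap (y k))"
      by (rule convex_on_sum[OF _ _ gap_convex a1]) (use a0 yI in auto)
    also have "(\<Sum>k\<in>{..n}. a k * gap (y k)) = (\<Sum>k<n. wt k * gap (Lk k \<omega>))"
      by (simp add: a_def y_def gap_def lessThan_Suc_atMost[symmetric])
    finally show "gap (p n \<omega>) \<le> (\<Sum>k<n. wt k * gap (Lk k \<omega>))" by (simp only: eq)
  qed
  have p_S: "(\<lambda>n. p n \<omega>) \<longlonglongrightarrow> S \<omega>" if "summable (\<lambda>k. wt k * Lk k \<omega>)" for \<omega>
  proof -
    have "(\<lambda>n. (\<Sum>k<n. wt k * Lk k \<omega>) + (1 / 2) ^ n) \<longlonglongrightarrow> (\<Sum>k. wt k * Lk k \<omega>) + 0"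
      by (intro tendsto_add summable_LIMSEQ that LIMSEQ_power_zero) simp
    with that show ?thesis by (simp add: p_def S_def)
  qed
  have half: "(1 + y) / 2 \<in> interior I" if "y \<in> closure I" for y
    using mem_interior_closure_convex_shrink[OF I_convex one_interior that, of "1/2"]
    by (simp add: field_simps)
  have S_closure: "S \<omega> \<in> closure I" if "\<omega> \<in> space M" for \<omega>
  proof (cases "summable (\<lambda>k. wt k * Lk k \<omega>)")
    case True
    then show ?thesis
      unfolding closure_sequential
      by (intro exI[of _ "\<lambda>n. p n \<omega>"] conjI allI p_I[OF that] p_S)
  next
    case False
    then show ?thesis using one_in_I closure_subset by (auto simp: S_def)
  qed
  have L_interior: "L \<omega> \<in> interior I" if "\<omega> \<in> space M" for \<omega>
    unfolding L_def by (rule half[OF S_closure[OF that]])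
  then have LI: "L \<omega> \<in> I" if "\<omega> \<in> space M" for \<omega>
    using that interior_subset by blast

  have "(\<integral>\<^sup>+ \<omega>. ennreal (S \<omega>) \<partial>M) = (\<integral>\<^sup>+ \<omega>. (\<Sum>k. ennreal (wt k * Lk k \<omega>)) \<partial>M)"
  proof (rule nn_integral_cong_AE)
    show "AE \<omega> in M. ennreal (S \<omega>) = (\<Sum>k. ennreal (wt k * Lk k \<omega>))"
      using summ AE_space
    proof eventually_elim
      case (elim \<omega>)
      then show ?case
        using wl0 by (simp add: S_def suminf_ennreal2)
    qed
  qed
  then have S_nn: "(\<integral>\<^sup>+ \<omega>. ennreal (S \<omega>) \<partial>M) = 1" using sums_int by simp
  have S0: "0 \<le> S \<omega>" if "\<omega> \<in> space M" for \<omega>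
    unfolding S_def using wl0[OF that] by (auto intro!: suminf_nonneg)
  have S_int: "integrable M S"
    using S_nn S0 by (intro integrableI_nonneg) auto
  have S_one: "(\<integral>\<omega>. S \<omega> \<partial>M) = 1"
    using S_nn S0 by (subst integral_eq_nn_integral) auto
  have L_int: "integrable M L" and L_one: "(\<integral>\<omega>. L \<omega> \<partial>M) = 1"
    unfolding L_def using S_int S_one by (simp_all add: prob_space)

  have gap_cont: "isCont gap y" if "y \<in> interior I" for y
  proof -
    have "continuous_on (interior I) gap"
      by (intro convex_on_continuous convex_on_subset[OF gap_convex interior_subset] convex_interior I_convex) simp
    with that show ?thesis by (simp add: continuous_on_eq_continuous_at)
  qed
  have gap_lim: "AE \<omega> in M. (\<lambda>n. ennreal (gap ((1 + p n \<omega>) / 2))) \<longlonglongrightarrow> ennreal (gap (L \<omega>))"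
    using summ AE_space
  proof eventually_elim
    case (elim \<omega>)
    have "(\<lambda>n. (1 + p n \<omega>) / 2) \<longlonglongrightarrow> L \<omega>"
      unfolding L_def by (intro tendsto_intros p_S elim(1)) simp
    from isCont_tendsto_compose[OF gap_cont[OF L_interior[OF elim(2)]] this]
    show ?case by (intro tendsto_ennrealI)
  qed
  have gap_n: "(\<integral>\<^sup>+ \<omega>. ennreal (gap ((1 + p n \<omega>) / 2)) \<partial>M) \<le> ennreal \<rho>" for n
  proof -
    have "gap ((1 + p n \<omega>) / 2) \<le> (\<Sum>k<n. wt k * gap (Lk k \<omega>))" if \<omega>: "\<omega> \<in> space M" for \<omega>
    proof -
      have "gap ((1 - 1 / 2) *\<^sub>R 1 + (1 / 2) *\<^sub>R p n \<omega>) \<le> (1 - 1 / 2) * gap 1 + 1 / 2 * gap (p n \<omega>)"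
        by (rule convex_onD[OF gap_convex]) (use p_I[OF \<omega>] one_in_I in auto)
      then have "gap ((1 + p n \<omega>) / 2) \<le> gap (p n \<omega>) / 2" by (simp add: gap_def add_divide_distrib)
      also have "\<dots> \<le> gap (p n \<omega>)" using gap0[OF p_I[OF \<omega>]] by simp
      also have "\<dots> \<le> (\<Sum>k<n. wt k * gap (Lk k \<omega>))" by (rule p_gap[OF \<omega>])
      finally show ?thesis .
    qed
    then have "(\<integral>\<^sup>+ \<omega>. ennreal (gap ((1 + p n \<omega>) / 2)) \<partial>M)
        \<le> (\<integral>\<^sup>+ \<omega>. ennreal (\<Sum>k<n. wt k * gap (Lk k \<omega>)) \<partial>M)"
      by (intro nn_integral_mono ennreal_leI) auto
    also have "\<dots> = ennreal (\<integral>\<omega>. (\<Sum>k<n. wt k * gap (Lk k \<omega>)) \<partial>M)"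
      using gap_int wt0 gap0 LkI
      by (intro nn_integral_eq_integral) (auto intro!: AE_I2 sum_nonneg mult_nonneg_nonneg intro: less_imp_le)
    also have "\<dots> \<le> ennreal \<rho>"
    proof (rule ennreal_leI)
      have "(\<integral>\<omega>. (\<Sum>k<n. wt k * gap (Lk k \<omega>)) \<partial>M) = (\<Sum>k<n. wt k * (\<integral>\<omega>. gap (Lk k \<omega>) \<partial>M))"
        using gap_int by simp
      also have "\<dots> \<le> (\<Sum>k<n. wt k * \<rho>)"
        using gap_le wt0 by (intro sum_mono mult_left_mono) (auto intro: less_imp_le)
      also have "\<dots> = (\<Sum>k<n. wt k) * \<rho>" by (simp add: sum_distrib_right)
      also have "\<dots> \<le> 1 * \<rho>"
      proof (rule mult_right_mono)
        have "0 \<le> (1 / 2 :: real) ^ n" by simp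
        with wt_sum[of n] show "(\<Sum>k<n. wt k) \<le> 1" by linarith
      qed (use rho_pos in simp)
      finally show "(\<integral>\<omega>. (\<Sum>k<n. wt k * gap (Lk k \<omega>)) \<partial>M) \<le> \<rho>" by simp
    qed
    finally show ?thesis .
  qed
  have "(\<integral>\<^sup>+ \<omega>. ennreal (gap (L \<omega>)) \<partial>M)
      = (\<integral>\<^sup>+ \<omega>. liminf (\<lambda>n. ennreal (gap ((1 + p n \<omega>) / 2))) \<partial>M)"
    using gap_lim by (intro nn_integral_cong_AE) (auto elim!: eventually_mono simp: lim_imp_Liminf)
  also have "\<dots> \<le> liminf (\<lambda>n. \<integral>\<^sup>+ \<omega>. ennreal (gap ((1 + p n \<omega>) / 2)) \<partial>M)"
    by (rule nn_integral_liminf) (simp add: p_def)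
  also have "\<dots> \<le> ennreal \<rho>"
    using gap_n by (intro Liminf_le) auto
  finally have gapL: "(\<integral>\<^sup>+ \<omega>. ennreal (gap (L \<omega>)) \<partial>M) \<le> ennreal \<rho>" .
  have gapL_int: "integrable M (\<lambda>\<omega>. gap (L \<omega>))"
    using gapL gap0[OF LI] by (intro integrableI_nonneg) (auto intro: le_less_trans)
  have gapL_le: "(\<integral>\<omega>. gap (L \<omega>) \<partial>M) \<le> \<rho>"
    using gapL gap0[OF LI] rho_pos by (subst integral_eq_nn_integral) (auto intro: enn2real_leI)
  have F_gap: "F (L \<omega>) = gap (L \<omega>) + (F 1 + c * (L \<omega> - 1))" for \<omega> by (simp add: gap_def)
  have F_int: "integrable M (\<lambda>\<omega>. F (L \<omega>))"
    unfolding F_gap using gapL_int L_int by simp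
  have F_le: "(\<integral>\<omega>. F (L \<omega>) \<partial>M) \<le> F 1 + \<rho>"
    unfolding F_gap using gapL_int L_int L_one gapL_le by (simp add: prob_space)

  have "of_nat k \<le> (\<integral>\<^sup>+ \<omega>. ennreal (L \<omega> * Y \<omega>) \<partial>M)" for k
  proof -
    have int: "integrable M (\<lambda>\<omega>. wt k / 2 * (Lk k \<omega> * Y \<omega>))"
      using admissibleD(5)[OF Lk(1), of k] by simp
    have "real k = wt k / 2 * (real k * 2 ^ (k + 2))"
      by (simp add: wt_def power_one_over)
    also have "\<dots> \<le> wt k / 2 * (\<integral>\<omega>. Lk k \<omega> * Y \<omega> \<partial>M)"
      using Lk(4)[of k] wt0[of k] by (intro mult_left_mono) auto
    also have "\<dots> = (\<integral>\<omega>. wt k / 2 * (Lk k \<omega> * Y \<omega>) \<partial>M)" by simp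
    finally have "ennreal (real k) \<le> ennreal (\<integral>\<omega>. wt k / 2 * (Lk k \<omega> * Y \<omega>) \<partial>M)"
      by (rule ennreal_leI)
    also have "\<dots> = (\<integral>\<^sup>+ \<omega>. ennreal (wt k / 2 * (Lk k \<omega> * Y \<omega>)) \<partial>M)"
      using int wt0[of k] Lk0 Y0
      by (intro nn_integral_eq_integral[symmetric]) (auto intro!: AE_I2)
    also have "\<dots> \<le> (\<integral>\<^sup>+ \<omega>. ennreal (L \<omega> * Y \<omega>) \<partial>M)"
    proof (rule nn_integral_mono_AE)
      show "AE \<omega> in M. ennreal (wt k / 2 * (Lk k \<omega> * Y \<omega>)) \<le> ennreal (L \<omega> * Y \<omega>)"
        using summ AE_space
      proof eventually_elim
        case (elim \<omega>)
        have "(\<Sum>i\<in>{k}. wt i * Lk i \<omega>) \<le> (\<Sum>i. wt i * Lk i \<omega>)"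
          by (rule sum_le_suminf[OF elim(1)])
             (use wl0[OF elim(2)] in auto)
        then have "wt k / 2 * Lk k \<omega> \<le> L \<omega>" using elim(1) by (simp add: L_def S_def)
        then have "wt k / 2 * Lk k \<omega> * Y \<omega> \<le> L \<omega> * Y \<omega>"
          using Y0[OF elim(2)] by (rule mult_right_mono)
        then show ?case by (intro ennreal_leI) (simp add: mult.assoc)
      qed
    qed
    finally show ?thesis by (simp add: ennreal_of_nat_eq_real_of_nat)
  qed
  then have "(\<integral>\<^sup>+ \<omega>. ennreal (L \<omega> * Y \<omega>) \<partial>M) = \<infinity>"
    by (metis ennreal_Ex_less_of_nat infinity_ennreal_def leD less_top)
  with L_meas LI L_int L_one F_int F_le show thesis by (rule that)
qed

end

section \<open>The uncertainty set in terms of likelihoods\<close>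

context divergence_model
begin

lemma uncertainty_set_density:
  assumes one: "1 \<in> I" and L[measurable]: "L \<in> borel_measurable M"
    and nonneg: "\<And>\<omega>. \<omega> \<in> space M \<Longrightarrow> 0 \<le> L \<omega>" and LI: "AE \<omega> in M. L \<omega> \<in> I"
    and int: "integrable M L" "(\<integral>\<omega>. L \<omega> \<partial>M) = 1"
    and div: "integrable M (\<lambda>\<omega>. F (L \<omega>))" "(\<integral>\<omega>. F (L \<omega>) \<partial>M) \<le> F 1 + \<rho>"
  shows "density M (\<lambda>\<omega>. ennreal (L \<omega>)) \<in> uncertainty_set f \<rho> M"
proof -
  let ?N = "density M (\<lambda>\<omega>. ennreal (L \<omega>))"
  have "(\<integral>\<^sup>+ \<omega>. ennreal (L \<omega>) \<partial>M) = 1"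
    using nn_integral_eq_integral[OF int(1)] nonneg int(2) by simp
  then have "prob_space ?N"
    by (intro prob_spaceI) (simp add: emeasure_density cong: nn_integral_cong)
  have "AE \<omega> in M. ennreal (L \<omega>) = RN_deriv M ?N \<omega>"
    by (rule RN_deriv_unique) simp_all
  then have "AE \<omega> in M. f (enn2real (RN_deriv M ?N \<omega>)) = ereal (F (L \<omega>))"
    using LI AE_space
  proof eventually_elim
    case (elim \<omega>)
    have "enn2real (RN_deriv M ?N \<omega>) = L \<omega>"
      using elim(1) nonneg[OF elim(3)] by (metis enn2real_ennreal)
    then show ?case using f_finite[OF elim(2)] by auto
  qed
  from ext_integral_cong_AE[OF this] ext_integral_real[OF div(1)]
  have "f_divergence f M ?N = ereal (\<integral>\<omega>. F (L \<omega>) \<partial>M) - f 1"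
    by (simp add: f_divergence_def)
  then have "f_divergence f M ?N \<le> ereal \<rho>"
    using div(2) f_finite[OF one] by auto
  with \<open>prob_space ?N\<close> show ?thesis
    by (simp add: uncertainty_set_def absolutely_continuousI_density)
qed

lemma uncertainty_set_AE_cong:
  assumes "N \<in> uncertainty_set f \<rho> M" "AE \<omega> in M. X \<omega> = Y \<omega>"
  shows "ext_integral N X = ext_integral N Y"
  using assms by (intro ext_integral_cong_AE absolutely_continuous_AE[of N M]) (auto simp: uncertainty_set_def)

lemma worst_case_cong_AE:
  assumes "AE \<omega> in M. X \<omega> = Y \<omega>"
  shows "worst_case f \<rho> M X = worst_case f \<rho> M Y"
  unfolding worst_case_def using uncertainty_set_AE_cong[OF _ assms] by (intro SUP_cong) auto

text \<open>Infinite losses contribute \<open>f\<^sup>*(\<infinity>) = \<infinity>\<close> to the dual loss, and \<open>f 1\<close> enters it with positive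
  weight \<open>lam\<close>. This is what allows to replace the loss by a real function.\<close>

lemma finite_dual_loss:
  assumes X[measurable]: "X \<in> borel_measurable M" and lam: "0 < lam"
    and fin: "\<bar>dual_loss f \<rho> M X lam \<mu>\<bar> \<noteq> \<infinity>"
  shows "1 \<in> I" and "AE \<omega> in M. X \<omega> \<noteq> \<infinity>"
proof -
  show "1 \<in> I"
  proof (rule ccontr)
    assume "1 \<notin> I"
    then have "ereal lam * (ereal \<rho> + f 1) = \<infinity>" using f_outside lam by simp
    with fin show False by (simp only: dual_loss_def) simp
  qed
  let ?P = "\<lambda>\<omega>. conj_perspective f lam (X \<omega> - ereal \<mu>)"
  let ?B = "{\<omega> \<in> space M. X \<omega> = \<infinity>}"
  have "(\<integral>\<^sup>+ \<omega>. e2ennreal (?P \<omega>) \<partial>M) \<noteq> \<infinity>"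
    using fin ext_integral_eq_infinity[of M ?P] by (auto simp: dual_loss_def)
  moreover have "(\<integral>\<^sup>+ \<omega>. \<infinity> * indicator ?B \<omega> \<partial>M) \<le> (\<integral>\<^sup>+ \<omega>. e2ennreal (?P \<omega>) \<partial>M)"
    by (rule nn_integral_mono) (auto simp: indicator_def conj_perspective_infinity[OF lam])
  moreover have "(\<integral>\<^sup>+ \<omega>. \<infinity> * indicator ?B \<omega> \<partial>M) = \<infinity> * emeasure M ?B"
    by (rule nn_integral_cmult_indicator) simp
  ultimately have "emeasure M ?B = 0"
    by (cases "emeasure M ?B = 0") (auto simp: ennreal_top_mult top_unique)
  then show "AE \<omega> in M. X \<omega> \<noteq> \<infinity>"
    by (intro AE_I[of _ _ ?B]) auto
qed

lemma optimal_likelihood_cong_AE: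
  assumes "AE \<omega> in M. X \<omega> = Y \<omega>"
  shows "optimal_likelihood f M X lam \<mu> L \<longleftrightarrow> optimal_likelihood f M Y lam \<mu> L"
proof -
  have "likelihood_objective f M X lam \<mu> = likelihood_objective f M Y lam \<mu>"
    unfolding likelihood_objective_def fun_eq_iff using assms
    by (intro allI ext_integral_cong_AE) (auto elim!: eventually_mono)
  then show ?thesis by (simp add: optimal_likelihood_def)
qed

end

section \<open>Weak and strong duality\<close>

context interior_divergence_model
begin

text \<open>The tangent of \<open>f\<close> at \<open>1\<close> has integral \<open>f(1)\<close> along any likelihood of mass one. It bounds the integral
  of \<open>f\<close> from below, so a bounded divergence is an honest integral.\<close>

lemma uncertainty_set_likelihood:
  assumes N: "N \<in> uncertainty_set f \<rho> M"
  obtains L where "L \<in> borel_measurable M" "\<forall>\<omega>. 0 \<le> L \<omega>" "N = density M (\<lambda>\<omega>. ennreal (L \<omega>))"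
    "AE \<omega> in M. L \<omega> \<in> I" "integrable M L" "(\<integral>\<omega>. L \<omega> \<partial>M) = 1"
    "integrable M (\<lambda>\<omega>. F (L \<omega>))" "(\<integral>\<omega>. F (L \<omega>) \<partial>M) \<le> F 1 + \<rho>"
proof -
  interpret N: prob_space N using N by (simp add: uncertainty_set_def)
  have ac: "absolutely_continuous M N" "sets N = sets M" and div: "f_divergence f M N \<le> ereal \<rho>"
    using N by (auto simp: uncertainty_set_def)
  obtain L where L[measurable]: "L \<in> borel_measurable M"
    and RN: "AE \<omega> in M. RN_deriv M N \<omega> = ennreal (L \<omega>)" and L0: "\<And>\<omega>. 0 \<le> L \<omega>"
    using real_RN_deriv[OF N.finite_measure_axioms ac] by blast
  have N_eq: "N = density M (\<lambda>\<omega>. ennreal (L \<omega>))"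
    using density_RN_deriv[OF ac] density_cong[OF _ _ RN] by simp
  have "(\<integral>\<^sup>+ \<omega>. ennreal (L \<omega>) \<partial>M) = emeasure (density M (\<lambda>\<omega>. ennreal (L \<omega>))) (space M)"
    by (simp add: emeasure_density cong: nn_integral_cong)
  also have "\<dots> = 1"
    using N.emeasure_space_1 sets_eq_imp_space_eq[OF ac(2)] by (simp add: N_eq[symmetric])
  finally have L_nn: "(\<integral>\<^sup>+ \<omega>. ennreal (L \<omega>) \<partial>M) = 1" .
  have L_int: "integrable M L" using L_nn L0 by (intro integrableI_nonneg) auto
  have L_one: "(\<integral>\<omega>. L \<omega> \<partial>M) = 1" using L_nn L0 by (subst integral_eq_nn_integral) auto
  have "AE \<omega> in M. f (enn2real (RN_deriv M N \<omega>)) = f (L \<omega>)"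
    using RN by eventually_elim (simp add: L0)
  then have div_eq: "f_divergence f M N = ext_integral M (\<lambda>\<omega>. f (L \<omega>)) - f 1"
    by (simp add: f_divergence_def ext_integral_cong_AE)
  have upper: "ext_integral M (\<lambda>\<omega>. f (L \<omega>)) \<le> ereal (F 1 + \<rho>)"
    using div div_eq f_finite[OF one_in_I] by (cases "ext_integral M (\<lambda>\<omega>. f (L \<omega>))") auto
  have "ereal (F 1 + c * (L \<omega> - 1)) \<le> f (L \<omega>)" for \<omega>
    using subgradient[of "L \<omega>"] f_finite[of "L \<omega>"] f_outside[of "L \<omega>"] by (cases "L \<omega> \<in> I") auto
  then have "ext_integral M (\<lambda>\<omega>. ereal (F 1 + c * (L \<omega> - 1))) \<le> ext_integral M (\<lambda>\<omega>. f (L \<omega>))"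
    by (intro ext_integral_mono_AE) simp
  then have "ereal (F 1) \<le> ext_integral M (\<lambda>\<omega>. f (L \<omega>))"
    using L_int L_one by (subst (asm) ext_integral_real) (simp_all add: prob_space)
  with upper have fin: "\<bar>ext_integral M (\<lambda>\<omega>. f (L \<omega>))\<bar> \<noteq> \<infinity>" by auto
  have "(\<lambda>\<omega>. f (L \<omega>)) \<in> borel_measurable M" by simp
  note real = ext_integral_finite[OF this fin]
  have "AE \<omega> in M. L \<omega> \<in> I"
    using real(1) by eventually_elim (auto simp: eff_dom_def)
  moreover have "(\<integral>\<omega>. F (L \<omega>) \<partial>M) \<le> F 1 + \<rho>"
    using upper unfolding real(3) by simp
  ultimately show thesis
    using L L0 N_eq L_int L_one real(2) by (intro that) auto
qed

text \<open>Fenchel's inequality \<open>L X \<le> P + \<mu> L + lam f(L)\<close>, with \<open>P\<close> the maximal payoff, integrated against the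
  reference measure.\<close>

lemma weak_duality:
  assumes X[measurable]: "X \<in> borel_measurable M" and lam: "0 \<le> lam"
    and fin: "\<bar>dual_loss f \<rho> M (\<lambda>\<omega>. ereal (X \<omega>)) lam \<mu>\<bar> \<noteq> \<infinity>"
  shows "worst_case f \<rho> M (\<lambda>\<omega>. ereal (X \<omega>)) \<le> dual_loss f \<rho> M (\<lambda>\<omega>. ereal (X \<omega>)) lam \<mu>"
  unfolding worst_case_def
proof (rule SUP_least)
  fix N assume "N \<in> uncertainty_set f \<rho> M"
  then obtain L where L[measurable]: "L \<in> borel_measurable M" and L0: "\<forall>\<omega>. 0 \<le> L \<omega>"
    and N: "N = density M (\<lambda>\<omega>. ennreal (L \<omega>))" and LI: "AE \<omega> in M. L \<omega> \<in> I"
    and int: "integrable M L" "(\<integral>\<omega>. L \<omega> \<partial>M) = 1"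
    "integrable M (\<lambda>\<omega>. F (L \<omega>))" "(\<integral>\<omega>. F (L \<omega>) \<partial>M) \<le> F 1 + \<rho>"
    by (rule uncertainty_set_likelihood)
  define P where "P \<omega> = maximal_payoff lam (X \<omega> - \<mu>)" for \<omega>
  have D: "dual_loss f \<rho> M (\<lambda>\<omega>. ereal (X \<omega>)) lam \<mu> = ereal (lam * (\<rho> + F 1) + \<mu>) + ext_integral M P"
    using dual_loss_real[OF lam one_in_I] by (simp add: P_def[abs_def])
  have "\<bar>ext_integral M P\<bar> \<noteq> \<infinity>" using fin unfolding D by auto
  moreover have "P \<in> borel_measurable M" unfolding P_def by simp
  ultimately have P: "AE \<omega> in M. \<bar>P \<omega>\<bar> \<noteq> \<infinity>" "integrable M (\<lambda>\<omega>. real_of_ereal (P \<omega>))"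
    "ext_integral M P = ereal (\<integral>\<omega>. real_of_ereal (P \<omega>) \<partial>M)"
    using ext_integral_finite[of P M] by auto
  have "ext_integral N (\<lambda>\<omega>. ereal (X \<omega>)) = ext_integral M (\<lambda>\<omega>. ereal (L \<omega> * X \<omega>))"
    unfolding N using L0 by (subst ext_integral_density) simp_all
  also have "\<dots> \<le> ext_integral M (\<lambda>\<omega>. ereal (real_of_ereal (P \<omega>) + \<mu> * L \<omega> + lam * F (L \<omega>)))"
  proof (rule ext_integral_mono_AE)
    show "AE \<omega> in M. ereal (L \<omega> * X \<omega>) \<le> ereal (real_of_ereal (P \<omega>) + \<mu> * L \<omega> + lam * F (L \<omega>))"
      using P(1) LI
    proof eventually_elim
      case (elim \<omega>)
      from maximal_payoff_upper[OF elim(2), of "X \<omega> - \<mu>" lam] elim(1)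
      have "L \<omega> * (X \<omega> - \<mu>) - lam * F (L \<omega>) \<le> real_of_ereal (P \<omega>)"
        unfolding P_def by (cases "maximal_payoff lam (X \<omega> - \<mu>)") auto
      then show ?case by (simp add: algebra_simps)
    qed
  qed
  also have "\<dots> = ereal ((\<integral>\<omega>. real_of_ereal (P \<omega>) \<partial>M) + \<mu> + lam * (\<integral>\<omega>. F (L \<omega>) \<partial>M))"
    using P(2) int by (subst ext_integral_real) simp_all
  also have "\<dots> \<le> ereal ((\<integral>\<omega>. real_of_ereal (P \<omega>) \<partial>M) + \<mu> + lam * (F 1 + \<rho>))"
    using int(4) lam by (simp add: mult_left_mono)
  also have "\<dots> = dual_loss f \<rho> M (\<lambda>\<omega>. ereal (X \<omega>)) lam \<mu>"
    unfolding D P(3) by (simp add: algebra_simps)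
  finally show "ext_integral N (\<lambda>\<omega>. ereal (X \<omega>)) \<le> dual_loss f \<rho> M (\<lambda>\<omega>. ereal (X \<omega>)) lam \<mu>" .
qed

lemma reference_measure_uncertainty: "M \<in> uncertainty_set f \<rho> M"
proof -
  have "density M (\<lambda>\<omega>. ennreal ((\<lambda>_. 1) \<omega>)) \<in> uncertainty_set f \<rho> M"
    using one_in_I rho_pos by (intro uncertainty_set_density) (auto simp: prob_space)
  then show ?thesis by (simp add: density_1)
qed

text \<open>Where the dual loss is finite somewhere, the bound \<open>d\<close> keeps it above \<open>-\<infinity>\<close> everywhere; this yields an
  admissible likelihood, and with it multipliers for every real upper bound \<open>w\<close> of the worst case.
  Where it is \<open>\<infinity>\<close> throughout, no such multipliers can exist for the positive part \<open>Y\<close> of the loss, for which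
  the constant likelihood \<open>1\<close> is admissible, so the expectations of \<open>Y\<close> have no real upper bound.\<close>

lemma strong_duality_real:
  assumes X[measurable]: "X \<in> borel_measurable M"
    and pos: "(\<integral>\<^sup>+ \<omega>. ennreal (X \<omega>) \<partial>M) \<noteq> \<infinity>"
    and d: "\<And>lam \<mu>. 0 \<le> lam \<Longrightarrow> ereal d \<le> dual_loss f \<rho> M (\<lambda>\<omega>. ereal (X \<omega>)) lam \<mu>"
  shows "ereal d \<le> worst_case f \<rho> M (\<lambda>\<omega>. ereal (X \<omega>))"
proof (cases "\<exists>lam \<mu>. 0 \<le> lam \<and> dual_loss f \<rho> M (\<lambda>\<omega>. ereal (X \<omega>)) lam \<mu> \<noteq> \<infinity>")
  case True
  then obtain lam \<mu> where lam: "0 \<le> lam" "dual_loss f \<rho> M (\<lambda>\<omega>. ereal (X \<omega>)) lam \<mu> \<noteq> \<infinity>" by blast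
  moreover have "dual_loss f \<rho> M (\<lambda>\<omega>. ereal (X \<omega>)) (lam + 1) (\<mu> + 1 - c) \<noteq> -\<infinity>"
    using d[of "lam + 1" "\<mu> + 1 - c"] lam(1) by auto
  ultimately obtain L0 where L0: "L0 \<in> admissible X"
    using admissible_nonempty[OF X] by blast
  show ?thesis
  proof (rule ereal_le_real)
    fix w assume w: "worst_case f \<rho> M (\<lambda>\<omega>. ereal (X \<omega>)) \<le> ereal w"
    have bound: "(\<integral>\<omega>. L \<omega> * X \<omega> \<partial>M) \<le> w"
      if L: "L \<in> admissible X" and 1: "(\<integral>\<omega>. L \<omega> \<partial>M) = 1" "(\<integral>\<omega>. F (L \<omega>) \<partial>M) \<le> F 1 + \<rho>" for L
    proof -
      note adm = admissibleD[OF L]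
      have L0: "0 \<le> L \<omega>" if "\<omega> \<in> space M" for \<omega> by (rule I_nonneg[OF adm(2)[OF that]])
      have "density M (\<lambda>\<omega>. ennreal (L \<omega>)) \<in> uncertainty_set f \<rho> M"
        using one_in_I adm 1 L0 by (intro uncertainty_set_density) auto
      then have "ext_integral (density M (\<lambda>\<omega>. ennreal (L \<omega>))) (\<lambda>\<omega>. ereal (X \<omega>)) \<le> ereal w"
        using w unfolding worst_case_def SUP_le_iff by blast
      moreover have "ext_integral (density M (\<lambda>\<omega>. ennreal (L \<omega>))) (\<lambda>\<omega>. ereal (X \<omega>)) = ereal (\<integral>\<omega>. L \<omega> * X \<omega> \<partial>M)"
        using ext_integral_real[OF adm(5)] adm(1) L0 by (subst ext_integral_density) simp_all
      ultimately show ?thesis by simp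
    qed
    obtain lam' \<mu>' where "0 \<le> lam'" "dual_loss f \<rho> M (\<lambda>\<omega>. ereal (X \<omega>)) lam' \<mu>' \<le> ereal w"
      using dual_loss_le_of_primal_bound[OF X L0 bound] by blast
    with d show "ereal d \<le> ereal w" by (blast intro: order_trans)
  qed
next
  case False
  define Y where "Y \<omega> = max 0 (X \<omega>)" for \<omega>
  have Y[measurable]: "Y \<in> borel_measurable M" unfolding Y_def by simp
  have Y_dual: "dual_loss f \<rho> M (\<lambda>\<omega>. ereal (Y \<omega>)) lam \<mu> = \<infinity>" if lam: "0 \<le> lam" for lam \<mu>
  proof -
    have "ext_integral M (\<lambda>\<omega>. maximal_payoff lam (X \<omega> - \<mu>)) \<le> ext_integral M (\<lambda>\<omega>. maximal_payoff lam (Y \<omega> - \<mu>))"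
      by (intro ext_integral_mono_AE AE_I2 maximal_payoff_mono) (simp add: Y_def)
    moreover have "dual_loss f \<rho> M (\<lambda>\<omega>. ereal (X \<omega>)) lam \<mu> = \<infinity>" using False lam by blast
    ultimately show ?thesis unfolding dual_loss_real[OF lam one_in_I] by auto
  qed
  have "integrable M Y"
  proof (rule integrableI_nonneg)
    have "ennreal (Y \<omega>) = ennreal (X \<omega>)" for \<omega> by (simp add: Y_def max_def ennreal_neg)
    then show "(\<integral>\<^sup>+ \<omega>. ennreal (Y \<omega>) \<partial>M) < \<infinity>" using pos by (simp add: less_top)
  qed (auto simp: Y_def)
  then have one_adm: "(\<lambda>_. 1) \<in> admissible Y"
    using one_in_I by (simp add: admissible_def)
  have "\<exists>L\<in>admissible Y. (\<integral>\<omega>. L \<omega> \<partial>M) = 1 \<and> (\<integral>\<omega>. F (L \<omega>) \<partial>M) \<le> F 1 + \<rho>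
      \<and> w < (\<integral>\<omega>. L \<omega> * Y \<omega> \<partial>M)" for w
  proof (rule ccontr)
    assume "\<not> ?thesis"
    then have "(\<integral>\<omega>. L \<omega> * Y \<omega> \<partial>M) \<le> w"
      if "L \<in> admissible Y" "(\<integral>\<omega>. L \<omega> \<partial>M) = 1" "(\<integral>\<omega>. F (L \<omega>) \<partial>M) \<le> F 1 + \<rho>" for L
      using that by (auto simp: not_less)
    then obtain lam \<mu> where "0 \<le> lam" "dual_loss f \<rho> M (\<lambda>\<omega>. ereal (Y \<omega>)) lam \<mu> \<le> ereal w"
      using dual_loss_le_of_primal_bound[OF Y one_adm] by blast
    with Y_dual show False by simp
  qed
  then obtain L where L[measurable]: "L \<in> borel_measurable M" and LI: "\<And>\<omega>. \<omega> \<in> space M \<Longrightarrow> L \<omega> \<in> I"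
    and L: "integrable M L" "(\<integral>\<omega>. L \<omega> \<partial>M) = 1" "integrable M (\<lambda>\<omega>. F (L \<omega>))" "(\<integral>\<omega>. F (L \<omega>) \<partial>M) \<le> F 1 + \<rho>"
    and inf: "(\<integral>\<^sup>+ \<omega>. ennreal (L \<omega> * Y \<omega>) \<partial>M) = \<infinity>"
    using infinite_expectation_mixture[OF Y] by (auto simp: Y_def)
  have L0: "0 \<le> L \<omega>" if "\<omega> \<in> space M" for \<omega> by (rule I_nonneg[OF LI[OF that]])
  let ?N = "density M (\<lambda>\<omega>. ennreal (L \<omega>))"
  have N: "?N \<in> uncertainty_set f \<rho> M"
    using one_in_I LI L L0 by (intro uncertainty_set_density) auto
  have "ext_integral ?N (\<lambda>\<omega>. ereal (X \<omega>)) = ext_integral M (\<lambda>\<omega>. ereal (L \<omega> * X \<omega>))"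
    using L0 by (subst ext_integral_density) simp_all
  also have "\<dots> = \<infinity>"
  proof (rule ext_integral_eq_infinity)
    have "(\<integral>\<^sup>+ \<omega>. e2ennreal (ereal (L \<omega> * X \<omega>)) \<partial>M) = (\<integral>\<^sup>+ \<omega>. ennreal (L \<omega> * Y \<omega>) \<partial>M)"
      using L0 by (intro nn_integral_cong) (auto simp: Y_def max_def ennreal_neg mult_nonneg_nonpos)
    with inf show "(\<integral>\<^sup>+ \<omega>. e2ennreal (ereal (L \<omega> * X \<omega>)) \<partial>M) = \<infinity>" by simp
  qed
  finally have "ext_integral ?N (\<lambda>\<omega>. ereal (X \<omega>)) = \<infinity>" .
  with N have "worst_case f \<rho> M (\<lambda>\<omega>. ereal (X \<omega>)) = \<infinity>"
    unfolding worst_case_def by (metis SUP_upper ereal_infty_less_eq(1))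
  then show ?thesis by simp
qed

text \<open>If the positive part of the loss has infinite integral under the reference measure, the worst case
  is \<open>\<infinity>\<close> because that measure belongs to the uncertainty set. Otherwise the loss is almost everywhere
  real and the previous lemma applies.\<close>

lemma strong_duality:
  assumes X[measurable]: "X \<in> borel_measurable M" and MInf: "AE \<omega> in M. X \<omega> \<noteq> -\<infinity>"
    and d: "\<And>lam \<mu>. 0 \<le> lam \<Longrightarrow> ereal d \<le> dual_loss f \<rho> M X lam \<mu>"
  shows "ereal d \<le> worst_case f \<rho> M X"
proof (cases "(\<integral>\<^sup>+ \<omega>. e2ennreal (X \<omega>) \<partial>M) = \<infinity>")
  case True
  then have "ext_integral M X = \<infinity>" by (rule ext_integral_eq_infinity)
  with reference_measure_uncertainty have "worst_case f \<rho> M X = \<infinity>"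
    unfolding worst_case_def by (metis SUP_upper ereal_infty_less_eq(1))
  then show ?thesis by simp
next
  case False
  define Z where "Z \<omega> = real_of_ereal (X \<omega>)" for \<omega>
  have Z[measurable]: "Z \<in> borel_measurable M" unfolding Z_def by simp
  have "AE \<omega> in M. e2ennreal (X \<omega>) \<noteq> \<infinity>"
    using False by (intro nn_integral_PInf_AE) auto
  with MInf have eq: "AE \<omega> in M. X \<omega> = ereal (Z \<omega>)"
  proof eventually_elim
    case (elim \<omega>)
    then show ?case by (cases "X \<omega>") (auto simp: Z_def)
  qed
  then have "AE \<omega> in M. e2ennreal (X \<omega>) = ennreal (Z \<omega>)" by eventually_elim simp
  from nn_integral_cong_AE[OF this] False
  have "(\<integral>\<^sup>+ \<omega>. ennreal (Z \<omega>) \<partial>M) \<noteq> \<infinity>" by simp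
  from strong_duality_real[OF Z this, of d] d
  show ?thesis
    unfolding dual_loss_cong_AE[OF eq] worst_case_cong_AE[OF eq] by blast
qed

end

section \<open>From the dual optimum to the primal solution\<close>

lemma (in prob_space) expectation_in_convex:
  fixes X :: "'a \<Rightarrow> real"
  assumes int: "integrable M X" and S: "convex S" and X: "AE x in M. X x \<in> S"
  shows "expectation X \<in> S"
proof (rule ccontr)
  let ?m = "expectation X"
  assume notin: "?m \<notin> S"
  have "(\<forall>x\<in>S. x < ?m) \<or> (\<forall>x\<in>S. ?m < x)"
  proof (rule ccontr)
    assume "\<not> ?thesis"
    then obtain x y where "x \<in> S" "?m \<le> x" "y \<in> S" "y \<le> ?m" by (auto simp: not_less)
    with S notin show False
      unfolding is_interval_convex_1[symmetric] is_interval_1 by blast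
  qed
  then show False
  proof
    assume "\<forall>x\<in>S. x < ?m"
    then have "?m < ?m" using X by (intro expectation_less[OF int]) (auto elim!: eventually_mono)
    then show False by simp
  next
    assume "\<forall>x\<in>S. ?m < x"
    then have "?m < ?m" using X by (intro expectation_greater[OF int]) (auto elim!: eventually_mono)
    then show False by simp
  qed
qed

text \<open>Stationarity makes the likelihood feasible with both constraints active, and then its expected loss equals
  the dual loss, which weak duality makes the largest possible value. Being the mean of a likelihood with values
  in the interior of the domain of \<open>f\<close>, the number \<open>1\<close> is interior as well.\<close>

lemma (in divergence_model) dual_optimum:
  assumes X[measurable]: "X \<in> borel_measurable M" and lam: "0 < lam" and one: "1 \<in> I" and rho: "0 < \<rho>"
    and diff: "\<And>y. y \<in> interior I \<Longrightarrow> F differentiable (at y)"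
    and fin: "\<forall>\<^sub>F p in nhds (lam, \<mu>). \<bar>dual_loss f \<rho> M (\<lambda>\<omega>. ereal (X \<omega>)) (fst p) (snd p)\<bar> \<noteq> \<infinity>"
    and min: "\<And>lam' \<mu>'. 0 \<le> lam' \<Longrightarrow> dual_loss f \<rho> M (\<lambda>\<omega>. ereal (X \<omega>)) lam \<mu>
      \<le> dual_loss f \<rho> M (\<lambda>\<omega>. ereal (X \<omega>)) lam' \<mu>'"
    and opt: "optimal_likelihood f M (\<lambda>\<omega>. ereal (X \<omega>)) lam \<mu> L"
    and L_int: "AE \<omega> in M. L \<omega> \<in> interior I"
  obtains c where "interior_divergence_model f M c \<rho>"
    and "integrable M L" and "(\<integral>\<omega>. L \<omega> \<partial>M) = 1"
    and "AE \<omega> in M. deriv F (L \<omega>) = (X \<omega> - \<mu>) / lam"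
    and "density M (\<lambda>\<omega>. ennreal (L \<omega>)) \<in> uncertainty_set f \<rho> M"
    and "ext_integral (density M (\<lambda>\<omega>. ennreal (L \<omega>))) (\<lambda>\<omega>. ereal (X \<omega>))
      = dual_loss f \<rho> M (\<lambda>\<omega>. ereal (X \<omega>)) lam \<mu>"
    and "worst_case f \<rho> M (\<lambda>\<omega>. ereal (X \<omega>)) = dual_loss f \<rho> M (\<lambda>\<omega>. ereal (X \<omega>)) lam \<mu>"
proof -
  define D where "D = dual_loss f \<rho> M (\<lambda>\<omega>. ereal (X \<omega>))"
  obtain e0 where e0: "0 < e0" and near: "\<And>p. dist p (lam, \<mu>) < e0 \<Longrightarrow> \<bar>D (fst p) (snd p)\<bar> \<noteq> \<infinity>"
    using fin unfolding eventually_nhds_metric D_def by blast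
  \<comment> \<open>At most \<open>lam\<close>, since the minimality of the dual loss extends only over nonnegative \<open>lam\<close>.\<close>
  define e where "e = min (e0 / 2) lam"
  have e: "0 < e" "e < e0" "e \<le> lam" using e0 lam by (auto simp: e_def)
  have fin_mu: "\<bar>D (lam + t * 0) (\<mu> + t * 1)\<bar> \<noteq> \<infinity>" if "\<bar>t\<bar> \<le> e" for t
    using near[of "(lam, \<mu> + t)"] that e by (simp add: dist_Pair_Pair dist_real_def)
  have fin_lam: "\<bar>D (lam + t * 1) (\<mu> + t * 0)\<bar> \<noteq> \<infinity>" if "\<bar>t\<bar> \<le> e" for t
    using near[of "(lam + t, \<mu>)"] that e by (simp add: dist_Pair_Pair dist_real_def)
  have D_fin: "\<bar>D lam \<mu>\<bar> \<noteq> \<infinity>" using fin_mu[of 0] e by simp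
  define P where "P \<omega> = maximal_payoff lam (X \<omega> - \<mu>)" for \<omega>
  have P_meas: "P \<in> borel_measurable M" unfolding P_def by simp
  have D_eq: "D lam \<mu> = ereal (lam * (\<rho> + F 1) + \<mu>) + ext_integral M P"
    using dual_loss_real[OF less_imp_le[OF lam] one, of \<rho> M X \<mu>] by (simp add: D_def P_def[abs_def])
  then have P_fin: "\<bar>ext_integral M P\<bar> \<noteq> \<infinity>" using D_fin by auto
  note P_real = ext_integral_finite[OF P_meas P_fin]
  have L[measurable]: "L \<in> borel_measurable M" and L0: "\<And>\<omega>. \<omega> \<in> space M \<Longrightarrow> 0 \<le> L \<omega>"
    using opt by (auto simp: optimal_likelihood_def likelihoods_def)
  have pointwise: "AE \<omega> in M. L \<omega> \<in> I \<and>
    (\<forall>y\<in>I. y \<noteq> L \<omega> \<longrightarrow> y * (X \<omega> - \<mu>) - lam * F y < L \<omega> * (X \<omega> - \<mu>) - lam * F (L \<omega>))"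
    by (rule optimal_likelihood_pointwise[OF X lam P_fin[unfolded P_def] opt])
  then have LI: "AE \<omega> in M. L \<omega> \<in> I"
    and strict: "AE \<omega> in M. \<forall>y\<in>I. y \<noteq> L \<omega> \<longrightarrow>
      y * (X \<omega> - \<mu>) - lam * F y < L \<omega> * (X \<omega> - \<mu>) - lam * F (L \<omega>)"
    by (auto elim!: eventually_mono)

  have "\<And>t. \<bar>t\<bar> \<le> e \<Longrightarrow> 0 \<le> lam + t * 0" "\<And>t. \<bar>t\<bar> \<le> e \<Longrightarrow> 0 \<le> lam + t * 1"
    using lam e(3) by auto
  note stationary =
    dual_loss_stationary[OF X lam one L L_int strict e(1) this(1) fin_mu[unfolded D_def] min[OF this(1)]]
    dual_loss_stationary[OF X lam one L L_int strict e(1) this(2) fin_lam[unfolded D_def] min[OF this(2)]]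
  then have L_integrable: "integrable M L" and L_one: "(\<integral>\<omega>. L \<omega> \<partial>M) = 1"
    and F_integrable: "integrable M (\<lambda>\<omega>. F (L \<omega>))" and F_rho: "(\<integral>\<omega>. F (L \<omega>) \<partial>M) = \<rho> + F 1"
    by simp_all

  have deriv: "AE \<omega> in M. deriv F (L \<omega>) = (X \<omega> - \<mu>) / lam"
    using strict L_int
  proof eventually_elim
    case (elim \<omega>)
    show ?case
    proof (rule deriv_at_payoff_maximiser[OF elim(2) lam diff[OF elim(2)]])
      fix y assume "y \<in> I"
      with elim(1) show "y * (X \<omega> - \<mu>) - lam * F y \<le> L \<omega> * (X \<omega> - \<mu>) - lam * F (L \<omega>)"
        by (cases "y = L \<omega>") auto
    qed
  qed

  have one_interior: "1 \<in> interior I"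
    using expectation_in_convex[OF L_integrable convex_interior[OF I_convex] L_int] L_one by simp
  have model: "interior_divergence_model f M (deriv F 1) \<rho>"
  proof unfold_locales
    fix y assume y: "y \<in> I"
    have "(F has_real_derivative deriv F 1) (at 1 within I)"
      using diff[OF one_interior] DERIV_deriv_iff_real_differentiable has_field_derivative_at_within by blast
    from convex_on_imp_above_tangent[OF F_convex convex_connected[OF I_convex] one_interior y this]
    show "F 1 + deriv F 1 * (y - 1) \<le> F y" by simp
  qed (use one_interior rho in auto)
  interpret interior_divergence_model f M "deriv F 1" \<rho> by (rule model)

  let ?N = "density M (\<lambda>\<omega>. ennreal (L \<omega>))"
  have N: "?N \<in> uncertainty_set f \<rho> M"
    using L_integrable L_one F_integrable F_rho L0 LI by (intro uncertainty_set_density[OF one]) auto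
  have LX: "AE \<omega> in M. ereal (L \<omega> * X \<omega>) = ereal (real_of_ereal (P \<omega>) + \<mu> * L \<omega> + lam * F (L \<omega>))"
    using pointwise
  proof eventually_elim
    case (elim \<omega>)
    have "P \<omega> = ereal (L \<omega> * (X \<omega> - \<mu>) - lam * F (L \<omega>))"
      unfolding P_def
    proof (rule antisym[OF maximal_payoff_least maximal_payoff_upper])
      fix y assume "y \<in> I"
      with elim show "ereal (y * (X \<omega> - \<mu>) - lam * F y) \<le> ereal (L \<omega> * (X \<omega> - \<mu>) - lam * F (L \<omega>))"
        by (cases "y = L \<omega>") (auto intro: less_imp_le)
    qed (use elim in simp)
    then show ?case by (simp add: algebra_simps)
  qed
  have "ext_integral ?N (\<lambda>\<omega>. ereal (X \<omega>)) = ext_integral M (\<lambda>\<omega>. ereal (L \<omega> * X \<omega>))"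
    using L0 by (subst ext_integral_density) simp_all
  also have "\<dots> = ereal (\<integral>\<omega>. real_of_ereal (P \<omega>) + \<mu> * L \<omega> + lam * F (L \<omega>) \<partial>M)"
    unfolding ext_integral_cong_AE[OF LX] using P_real(2) L_integrable F_integrable
    by (intro ext_integral_real) simp
  also have "\<dots> = ereal ((\<integral>\<omega>. real_of_ereal (P \<omega>) \<partial>M) + \<mu> + lam * (\<rho> + F 1))"
    using P_real(2) L_integrable F_integrable by (simp add: L_one F_rho)
  also have "\<dots> = D lam \<mu>"
    unfolding D_eq P_real(3) by simp
  finally have attained: "ext_integral ?N (\<lambda>\<omega>. ereal (X \<omega>)) = D lam \<mu>" .
  have "worst_case f \<rho> M (\<lambda>\<omega>. ereal (X \<omega>)) = D lam \<mu>"
  proof (rule antisym)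
    show "worst_case f \<rho> M (\<lambda>\<omega>. ereal (X \<omega>)) \<le> D lam \<mu>"
      unfolding D_def using lam D_fin by (intro weak_duality[OF X]) (auto simp: D_def)
    show "D lam \<mu> \<le> worst_case f \<rho> M (\<lambda>\<omega>. ereal (X \<omega>))"
      unfolding attained[symmetric] worst_case_def using N by (rule SUP_upper)
  qed
  with model L_integrable L_one deriv N attained show thesis
    unfolding D_def by (rule that)
qed

theorem proposition2:
  fixes m :: "'w measure"
    and f :: "real \<Rightarrow> ereal"
    and A :: "'p::finite \<Rightarrow> 'v::euclidean_space set"
    and l :: "'p \<Rightarrow> ('p \<Rightarrow> 'v) \<Rightarrow> 'w \<Rightarrow> ereal"
    and a :: "'p \<Rightarrow> 'v"
    and j :: 'p
    and \<rho> lam_s \<mu>_s :: real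
    and L_s :: "'w \<Rightarrow> real"
  assumes prob: "prob_space m"
    and players: "CARD('p) \<ge> 2"
    and f_convex: "convex_ereal f"
    and f_proper: "proper_on UNIV f"
    and f_dom: "\<And>x. x < 0 \<Longrightarrow> f x = \<infinity>"
    and f_diff: "\<And>x. x \<in> interior (eff_dom f) \<Longrightarrow> (\<lambda>y. real_of_ereal (f y)) differentiable (at x)"
    and rho: "\<rho> > 0"
    and l_meas: "\<And>b. b \<in> Pi UNIV A \<Longrightarrow> l j b \<in> borel_measurable m"
    and l_proper: "AE \<omega> in m. proper_on (Pi UNIV A) (\<lambda>b. l j b \<omega>)"
    and l_usc: "AE \<omega> in m. usc_on (Pi UNIV A) (\<lambda>b. l j b \<omega>)"
    and others: "\<And>k. k \<noteq> j \<Longrightarrow> a k \<in> A k"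
    and compact_or_coercive:
      "(A j \<noteq> {} \<and> compact (A j)) \<or>
       (\<forall>N\<in>uncertainty_set f \<rho> m. coercive_on (A j) (\<lambda>x. ext_integral N (l j (a(j := x)))))"
    and dual: "solves_dual f \<rho> m A (l j) j a lam_s \<mu>_s"
    and lambda_pos: "lam_s > 0"
    and dual_finite: "\<forall>\<^sub>F p in nhds (lam_s, \<mu>_s). \<bar>dual_loss f \<rho> m (l j a) (fst p) (snd p)\<bar> \<noteq> \<infinity>"
    and optimal: "optimal_likelihood f m (l j a) lam_s \<mu>_s L_s"
    and L_s_interior: "AE \<omega> in m. L_s \<omega> \<in> interior (eff_dom f)"
  shows "integrable m L_s \<and> (\<integral>\<omega>. L_s \<omega> \<partial>m) = 1
    \<and> (AE \<omega> in m. ereal (deriv (\<lambda>y. real_of_ereal (f y)) (L_s \<omega>))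
                    = (l j a \<omega> - ereal \<mu>_s) / ereal lam_s)
    \<and> solves_primal f \<rho> m A (l j) j a (density m (\<lambda>\<omega>. ennreal (L_s \<omega>)))"
proof -
  interpret prob_space m by (rule prob)
  interpret divergence_model f m
    by unfold_locales (fact f_convex f_proper f_dom)+
  define Z where "Z \<omega> = real_of_ereal (l j a \<omega>)" for \<omega>
  define D where "D = dual_loss f \<rho> m (l j a)"
  have aj: "a j \<in> A j" and D_eq: "D lam_s \<mu>_s
      = (INF (x, lam', \<mu>')\<in>A j \<times> {0..} \<times> UNIV. dual_loss f \<rho> m (l j (a(j := x))) lam' \<mu>')"
    using dual by (auto simp: solves_dual_def D_def)
  have profile: "a(j := x) \<in> Pi UNIV A" if "x \<in> A j" for x
    using that others by auto
  have a: "a \<in> Pi UNIV A" using profile[OF aj] by simp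
  have not_MInf: "AE \<omega> in m. l j b \<omega> \<noteq> -\<infinity>" if "b \<in> Pi UNIV A" for b
    using l_proper by eventually_elim (use that in \<open>auto simp: proper_on_def\<close>)
  have D_min: "D lam_s \<mu>_s \<le> dual_loss f \<rho> m (l j (a(j := x))) lam' \<mu>'" if "x \<in> A j" "0 \<le> lam'" for x lam' \<mu>'
    unfolding D_eq by (rule INF_lower2[of "(x, lam', \<mu>')"]) (use that in auto)
  have D_fin: "\<bar>D lam_s \<mu>_s\<bar> \<noteq> \<infinity>"
    using eventually_nhds_x_imp_x[OF dual_finite] by (simp add: D_def)
  note finite = finite_dual_loss[OF l_meas[OF a] lambda_pos D_fin[unfolded D_def]]
  have eq: "AE \<omega> in m. l j a \<omega> = ereal (Z \<omega>)"
    using finite(2) not_MInf[OF a]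
  proof eventually_elim
    case (elim \<omega>)
    then show ?case by (cases "l j a \<omega>") (auto simp: Z_def)
  qed
  have Z: "Z \<in> borel_measurable m" unfolding Z_def using l_meas[OF a] by simp
  note D_Z = dual_loss_cong_AE[OF eq, of \<rho>]
  obtain c where model: "interior_divergence_model f m c \<rho>"
    and L: "integrable m L_s" "(\<integral>\<omega>. L_s \<omega> \<partial>m) = 1"
    and deriv: "AE \<omega> in m. deriv F (L_s \<omega>) = (Z \<omega> - \<mu>_s) / lam_s"
    and N: "density m (\<lambda>\<omega>. ennreal (L_s \<omega>)) \<in> uncertainty_set f \<rho> m"
    and attained: "ext_integral (density m (\<lambda>\<omega>. ennreal (L_s \<omega>))) (\<lambda>\<omega>. ereal (Z \<omega>)) = D lam_s \<mu>_s"
    and worst: "worst_case f \<rho> m (\<lambda>\<omega>. ereal (Z \<omega>)) = D lam_s \<mu>_s"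
  proof (rule dual_optimum[OF Z lambda_pos finite(1) rho f_diff, of \<mu>_s L_s])
    show "\<forall>\<^sub>F p in nhds (lam_s, \<mu>_s). \<bar>dual_loss f \<rho> m (\<lambda>\<omega>. ereal (Z \<omega>)) (fst p) (snd p)\<bar> \<noteq> \<infinity>"
      using dual_finite unfolding D_Z .
    show "dual_loss f \<rho> m (\<lambda>\<omega>. ereal (Z \<omega>)) lam_s \<mu>_s \<le> dual_loss f \<rho> m (\<lambda>\<omega>. ereal (Z \<omega>)) lam' \<mu>'"
      if "0 \<le> lam'" for lam' \<mu>'
      using D_min[OF aj that] by (simp add: D_def D_Z)
    show "optimal_likelihood f m (\<lambda>\<omega>. ereal (Z \<omega>)) lam_s \<mu>_s L_s"
      using optimal unfolding optimal_likelihood_cong_AE[OF eq] .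
  qed (use L_s_interior in \<open>simp_all add: D_def D_Z\<close>)
  interpret interior_divergence_model f m c \<rho> by (rule model)
  have worst_a: "worst_case f \<rho> m (l j a) = D lam_s \<mu>_s"
    using worst worst_case_cong_AE[OF eq] by simp
  have "worst_case f \<rho> m (l j a) \<le> worst_case f \<rho> m (l j (a(j := x)))" if x: "x \<in> A j" for x
  proof -
    obtain d where d: "D lam_s \<mu>_s = ereal d" using D_fin by (cases "D lam_s \<mu>_s") auto
    have "ereal d \<le> worst_case f \<rho> m (l j (a(j := x)))"
      using D_min[OF x] d by (intro strong_duality l_meas not_MInf profile x) auto
    then show ?thesis using worst_a d by simp
  qed
  then have inf: "worst_case f \<rho> m (l j a) = (INF x\<in>A j. worst_case f \<rho> m (l j (a(j := x))))"
    using aj by (intro antisym INF_greatest INF_lower2[of "a j"]) auto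
  have "ext_integral (density m (\<lambda>\<omega>. ennreal (L_s \<omega>))) (l j a) = worst_case f \<rho> m (l j a)"
    using uncertainty_set_AE_cong[OF N eq] attained worst_a by simp
  with aj inf N have primal: "solves_primal f \<rho> m A (l j) j a (density m (\<lambda>\<omega>. ennreal (L_s \<omega>)))"
    by (simp add: solves_primal_def)
  have "AE \<omega> in m. ereal (deriv F (L_s \<omega>)) = (l j a \<omega> - ereal \<mu>_s) / ereal lam_s"
    using deriv eq by eventually_elim (use lambda_pos in simp)
  with L primal show ?thesis by blast
qed

end
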